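(* For every $\rho$ with $0\le\rho\le 2$ there exists an entire function $\psi$ of order $\rho$ of the form $$\psi(z)=\prod_{n=1}^{\infty}\left(1-\frac{z}{x_n}\right)\exp\left(\frac{\lambda z}{x_n}\right)$$ (with $\lambda\in\{0,1\}$ and nonzero numbers $x_n$) such that for every $a<0$ the function $\varphi(z)=\exp(az^2)\psi(z)=\sum_{n=0}^{\infty}a_nz^n$ belongs to $\mathcal{LP}^a$ and has the property that for every $n_0\in\mathbb{N}$ there exists $n>n_0$ with $a_{n-1}a_{n+1}>0$.
   Context: The order of an entire function $f$ is $\limsup_{r\to\infty}\frac{\log\log M(r)}{\log r}$, where $M(r)=\max_{|z|=r}|f(z)|$. A real entire function $\varphi$ belongs to the Laguerre–Pólya class $\mathcal{LP}$ if it can be written as $$\varphi(z)=cz^m e^{az^2+bz}\prod_{k=1}^{\omega}(1-z/x_k)e^{\lambda z/x_k},\quad 0\le\omega\le\infty,$$ with $m$ a nonnegative integer, $c,a,b\in\mathbb{R}$, $a\le 0$, $\lambda\in\{0,1\}$, $x_k\in\mathbb{R}\setminus\{0\}$ and $\sum_k|x_k|^{-\lambda-1}<\infty$ (empty product $=1$). The subclass $\mathcal{LP}^a$ consists of those $\varphi\in\mathcal{LP}$ for which the constant $a$ in this representation is nonzero. *)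

theory Defs
  imports "HOL-Analysis.Analysis" "HOL-Library.Extended_Nat"
begin

definition max_modulus :: "(complex \<Rightarrow> complex) \<Rightarrow> real \<Rightarrow> real" where
  "max_modulus f r = Sup ((\<lambda>z. norm (f z)) ` sphere 0 r)"

definition entire_order :: "(complex \<Rightarrow> complex) \<Rightarrow> ereal" where
  "entire_order f = Limsup at_top (\<lambda>r::real. ereal (ln (ln (max_modulus f r)) / ln r))"

definition real_entire :: "(complex \<Rightarrow> complex) \<Rightarrow> bool" where
  "real_entire f \<longleftrightarrow> f holomorphic_on UNIV \<and> (\<forall>t::real. f (of_real t) \<in> \<real>)"

text \<open>Laguerre-Polya representation with parameters c, m, a, b, lambda, omega (number of
  zeros x_k, possibly infinite); factors with index k >= omega are 1.\<close>
definition LP_repr ::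
  "(complex \<Rightarrow> complex) \<Rightarrow> real \<Rightarrow> nat \<Rightarrow> real \<Rightarrow> real \<Rightarrow> real \<Rightarrow> enat \<Rightarrow> (nat \<Rightarrow> real) \<Rightarrow> bool" where
  "LP_repr \<phi> c m a b lam \<omega> x \<longleftrightarrow>
     a \<le> 0 \<and> lam \<in> {0, 1} \<and> (\<forall>k. enat k < \<omega> \<longrightarrow> x k \<noteq> 0) \<and>
     summable (\<lambda>k. if enat k < \<omega> then \<bar>x k\<bar> powr (- lam - 1) else 0) \<and>
     (\<exists>P. (\<forall>z. (\<lambda>k. if enat k < \<omega> then (1 - z / of_real (x k)) * exp (of_real lam * z / of_real (x k)) else 1)
                 has_prod P z) \<and>
          (\<forall>z. \<phi> z = of_real c * z ^ m * exp (of_real a * z\<^sup>2 + of_real b * z) * P z))"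

definition LP :: "(complex \<Rightarrow> complex) \<Rightarrow> bool" where
  "LP \<phi> \<longleftrightarrow> (\<exists>c m a b lam \<omega> x. LP_repr \<phi> c m a b lam \<omega> x)"

definition LPa :: "(complex \<Rightarrow> complex) \<Rightarrow> bool" where
  "LPa \<phi> \<longleftrightarrow> (\<exists>c m a b lam \<omega> x. LP_repr \<phi> c m a b lam \<omega> x \<and> a \<noteq> 0)"

definition taylor_coeff :: "(complex \<Rightarrow> complex) \<Rightarrow> nat \<Rightarrow> complex" where
  "taylor_coeff f n = (deriv ^^ n) f 0 / of_nat (fact n)"

end

theory Submission
  imports Defs "HOL-Complex_Analysis.Complex_Analysis"
    "HOL-Computational_Algebra.Fundamental_Theorem_Algebra" "HOL-Real_Asymp.Real_Asymp"
begin

unbundle no vec_syntax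

text \<open>
  If \<open>a\<^sub>n\<^sub>-\<^sub>1 a\<^sub>n\<^sub>+\<^sub>1 \<le> 0\<close> for all large \<open>n\<close> and only finitely many \<open>a\<^sub>2\<^sub>k\<close> vanish, then the
  coefficients \<open>(-1)\<^sup>k a\<^sub>2\<^sub>k\<close> of \<open>Re \<phi>(iy) = exp (-ay\<^sup>2) Re \<psi>(iy)\<close> eventually have constant sign, and so
  does \<open>Re \<psi>(iy)\<close> for large \<open>y\<close>. We take as zeros of \<open>\<psi>\<close> the numbers \<open>2\<^sup>n\<close>, one negative number, and
  infinitely many pairs \<open>\<plusminus>x\<close>. The pairs contribute a positive factor to \<open>\<psi>(iy)\<close> and adjust the
  order, while the zeros \<open>2\<^sup>n\<close> let the argument of \<open>\<psi>(iy)\<close> tend to \<open>-\<infinity>\<close>, so that \<open>Re \<psi>(iy)\<close> keeps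
  changing its sign.

  It remains to avoid that, for some of the uncountably many \<open>a\<close>, infinitely many \<open>a\<^sub>2\<^sub>k\<close> vanish. In
  \<open>w = z\<^sup>2\<close> the even part of \<open>\<phi>\<close> is \<open>e\<^sup>a\<^sup>w (1 - tw) E(w)\<close>, where \<open>\<plusminus>t\<^sup>-\<^sup>1\<^sup>/\<^sup>2\<close> is one of the pairs of zeros.
  The coefficients \<open>B\<^sub>k(a)\<close> of \<open>e\<^sup>a\<^sup>w E(w)\<close> are polynomials in \<open>a\<close> with \<open>B\<^sub>k' = B\<^sub>k\<^sub>-\<^sub>1\<close>. All zeros of \<open>E\<close> are
  real, so no \<open>B\<^sub>k\<close> has a double zero, and hence for all but countably many \<open>t\<close> no two of the polynomials
  \<open>B\<^sub>k - t B\<^sub>k\<^sub>-\<^sub>1\<close> have a common zero.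
\<close>

section \<open>Newton inequalities for real-rooted polynomials\<close>

text \<open>Nonzero real polynomials with only real roots, generated one linear factor at a time so
  that inequalities for \<open>p' / p\<close> can be proved by induction on the factors.\<close>

inductive real_split :: "real poly \<Rightarrow> bool" where
  const: "c \<noteq> 0 \<Longrightarrow> real_split [:c:]"
| linear: "real_split p \<Longrightarrow> real_split ([:-x, 1:] * p)"

abbreviation cpoly :: "real poly \<Rightarrow> complex poly" where
  "cpoly p \<equiv> map_poly of_real p"

lemma poly_cpoly_of_real: "poly (cpoly p) (of_real x) = of_real (poly p x)"
  by (induction p) (auto simp: map_poly_pCons)

lemma cpoly_mult: "cpoly (p * q) = cpoly p * cpoly q"
  by (rule poly_eqI) (simp add: coeff_map_poly coeff_mult)

lemma cpoly_add: "cpoly (p + q) = cpoly p + cpoly q"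
  by (rule poly_eqI) (simp add: coeff_map_poly)

lemma cpoly_smult: "cpoly (smult c p) = smult (of_real c) (cpoly p)"
  by (rule poly_eqI) (simp add: coeff_map_poly)

lemma cpoly_pderiv: "cpoly (pderiv p) = pderiv (cpoly p)"
  by (rule poly_eqI) (simp add: coeff_map_poly coeff_pderiv)

lemma cpoly_pCons: "cpoly (pCons c p) = pCons (of_real c) (cpoly p)"
  by (simp add: map_poly_pCons)

lemmas cpoly_simps = cpoly_mult cpoly_add cpoly_smult cpoly_pderiv cpoly_pCons

lemma Im_complex_of_real_mult: "Im (of_real x * z) = x * Im z"
  by simp

text \<open>Every complex root is real by assumption, so the fundamental theorem of algebra supplies
  a real linear factor; the quotient inherits the assumption.\<close>

lemma real_splitI:
  assumes "p \<noteq> 0" "\<And>z. poly (cpoly p) z = 0 \<Longrightarrow> Im z = 0"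
  shows   "real_split p"
  using assms
proof (induction "degree p" arbitrary: p)
  case 0
  then obtain c where "p = [:c:]" by (metis degree_eq_zeroE)
  with 0 show ?case by (auto intro: real_split.const)
next
  case (Suc n)
  have "degree (cpoly p) > 0"
    using Suc.hyps by (simp add: degree_map_poly)
  then obtain z where z: "poly (cpoly p) z = 0"
    using alg_closed_imp_poly_has_root[of "cpoly p"] by auto
  define x where "x = Re z"
  have "z = of_real x"
    using Suc.prems(2)[OF z] by (simp add: complex_eq_iff x_def)
  hence "poly p x = 0" using z by (simp add: poly_cpoly_of_real)
  then obtain q where q: "p = [:-x, 1:] * q"
    by (metis dvdE poly_eq_0_iff_dvd)
  have "q \<noteq> 0" using q Suc.prems by auto
  have "degree p = Suc (degree q)"
    unfolding q using \<open>q \<noteq> 0\<close> by (subst degree_mult_eq) auto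
  moreover have "Im w = 0" if "poly (cpoly q) w = 0" for w
    using that unfolding q by (intro Suc.prems(2)) (simp add: q cpoly_mult del: mult_pCons_left)
  ultimately have "real_split q"
    using Suc.hyps \<open>q \<noteq> 0\<close> by (intro Suc.hyps(1)) auto
  thus ?case unfolding q by (rule real_split.linear)
qed

lemma real_split_nonzero: "real_split p \<Longrightarrow> p \<noteq> 0"
proof (induction rule: real_split.induct)
  case (linear p x)
  thus ?case by (metis mult_eq_0_iff one_neq_zero pCons_eq_0_iff)
qed simp

lemma real_split_root_real:
  assumes "real_split p" "Im z \<noteq> 0"
  shows   "poly (cpoly p) z \<noteq> 0"
  using assms
proof (induction rule: real_split.induct)
  case (linear p x)
  hence "z \<noteq> of_real x" by auto
  thus ?case using linear unfolding cpoly_mult by (simp add: cpoly_pCons)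
qed (simp add: cpoly_pCons)

text \<open>The sign of \<open>Im (p' / p)\<close>, cleared of denominators.\<close>
lemma real_split_Im_log_deriv:
  assumes "real_split p" "Im z \<noteq> 0"
  shows   "Im z * Im (poly (cpoly (pderiv p)) z * cnj (poly (cpoly p) z)) \<le> 0"
    and   "degree p > 0 \<Longrightarrow> Im z * Im (poly (cpoly (pderiv p)) z * cnj (poly (cpoly p) z)) < 0"
proof -
  have "Im z * Im (poly (cpoly (pderiv p)) z * cnj (poly (cpoly p) z)) \<le> 0 \<and>
        (degree p > 0 \<longrightarrow> Im z * Im (poly (cpoly (pderiv p)) z * cnj (poly (cpoly p) z)) < 0)"
    using assms
  proof (induction rule: real_split.induct)
    case (const c)
    thus ?case by (simp add: pderiv_pCons)
  next
    case (linear p x)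
    define P where "P = poly (cpoly p) z"
    define P' where "P' = poly (cpoly (pderiv p)) z"
    have "P \<noteq> 0" using real_split_root_real[OF linear(1) linear(3)] by (simp add: P_def)
    define u where "u = z - of_real x"
    have [simp]: "poly (cpoly [:-x, 1:]) z = u" "poly (cpoly (pderiv [:-x, 1:])) z = 1"
      by (simp_all add: u_def cpoly_pCons pderiv_pCons)
    have "poly (cpoly (pderiv ([:-x, 1:] * p))) z = P + u * P'"
      unfolding P_def P'_def pderiv_mult cpoly_mult cpoly_add by (simp del: mult_pCons_left mult_pCons_right)
    moreover have "poly (cpoly ([:-x, 1:] * p)) z = u * P"
      unfolding P_def cpoly_mult by (simp del: mult_pCons_left mult_pCons_right)
    \<comment> \<open>This is \<open>p' / p\<close> gaining the summand \<open>1 / u\<close>,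
      multiplied through by \<open>|u P|^2\<close>.\<close>
    moreover have "(P + u * P') * cnj (u * P) = (P * cnj P) * cnj u + (u * cnj u) * (P' * cnj P)"
      by (simp add: algebra_simps)
    ultimately have "poly (cpoly (pderiv ([:-x, 1:] * p))) z * cnj (poly (cpoly ([:-x, 1:] * p)) z)
       = of_real ((norm P)\<^sup>2) * cnj u + of_real ((norm u)\<^sup>2) * (P' * cnj P)"
      by (simp only: complex_norm_square)
    hence Im: "Im (poly (cpoly (pderiv ([:-x, 1:] * p))) z * cnj (poly (cpoly ([:-x, 1:] * p)) z))
       = (norm P)\<^sup>2 * (- Im u) + (norm u)\<^sup>2 * Im (P' * cnj P)"
      by (simp only: plus_complex.sel Im_complex_of_real_mult cnj.sel)
    have "Im z * Im (poly (cpoly (pderiv ([:-x, 1:] * p))) z * cnj (poly (cpoly ([:-x, 1:] * p)) z))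
       = - (Im z)\<^sup>2 * (norm P)\<^sup>2 + (norm u)\<^sup>2 * (Im z * Im (P' * cnj P))"
      unfolding Im by (simp add: u_def power2_eq_square algebra_simps del: complex_mult_cnj times_complex.sel)
    moreover have "(norm u)\<^sup>2 * (Im z * Im (P' * cnj P)) \<le> 0"
      unfolding P_def P'_def
      by (rule mult_nonneg_nonpos[OF zero_le_power2 conjunct1[OF linear.IH[OF linear.prems]]])
    moreover have "- (Im z)\<^sup>2 * (norm P)\<^sup>2 < 0" using \<open>P \<noteq> 0\<close> linear by simp
    ultimately show ?case by linarith
  qed
  thus "Im z * Im (poly (cpoly (pderiv p)) z * cnj (poly (cpoly p) z)) \<le> 0"
    "degree p > 0 \<Longrightarrow> Im z * Im (poly (cpoly (pderiv p)) z * cnj (poly (cpoly p) z)) < 0" by blast+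
qed

text \<open>At a nonreal root of \<open>p' + a p\<close> the quotient \<open>p' / p\<close> would
  equal the real number \<open>-a\<close>, against the strict sign of its imaginary part. For
  constant \<open>p\<close> there is no strict sign, and \<open>a \<noteq> 0\<close> decides
  instead.\<close>

lemma real_split_deriv_shift:
  assumes "real_split p" "a \<noteq> 0"
  shows   "real_split (pderiv p + smult a p)"
proof (rule real_splitI)
  have "coeff (pderiv p + smult a p) (degree p) = a * lead_coeff p"
    by (simp add: coeff_pderiv coeff_eq_0)
  thus "pderiv p + smult a p \<noteq> 0"
    using assms(2) real_split_nonzero[OF assms(1)] by fastforce
next
  fix z assume z: "poly (cpoly (pderiv p + smult a p)) z = 0"
  show "Im z = 0"
  proof (rule ccontr)
    assume "Im z \<noteq> 0"
    define P where "P = poly (cpoly p) z"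
    have "P \<noteq> 0" using real_split_root_real[OF assms(1) \<open>Im z \<noteq> 0\<close>] by (simp add: P_def)
    have eq: "poly (cpoly (pderiv p)) z = - of_real a * P"
      using z by (simp add: cpoly_simps P_def add_eq_0_iff)
    show False
    proof (cases "degree p = 0")
      case True
      then obtain c where "p = [:c:]" by (metis degree_eq_zeroE)
      hence "of_real a * P = 0" using eq by (simp add: pderiv_pCons)
      thus False using \<open>P \<noteq> 0\<close> assms by simp
    next
      case False
      have "poly (cpoly (pderiv p)) z * cnj P = - of_real (a * (norm P)\<^sup>2)"
        unfolding eq using complex_norm_square[of P] by simp
      hence "Im (poly (cpoly (pderiv p)) z * cnj P) = 0" by simp
      with real_split_Im_log_deriv(2)[OF assms(1) \<open>Im z \<noteq> 0\<close>] False show False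
        by (simp add: P_def)
    qed
  qed
qed

text \<open>The quantity \<open>p'^2 - p p''\<close> is \<open>- p^2 (log p)''\<close>. A new linear
  factor multiplies it by a square and adds \<open>p^2\<close>, which also covers the points where
  \<open>p\<close> vanishes.\<close>

lemma real_split_Laguerre:
  assumes "real_split p"
  shows   "poly p x * poly (pderiv (pderiv p)) x \<le> (poly (pderiv p) x)\<^sup>2"
  using assms
proof (induction rule: real_split.induct)
  case (linear p y)
  have "(poly (pderiv ([:-y, 1:] * p)) x)\<^sup>2 - poly ([:-y, 1:] * p) x * poly (pderiv (pderiv ([:-y, 1:] * p))) x
     = (x - y)\<^sup>2 * ((poly (pderiv p) x)\<^sup>2 - poly p x * poly (pderiv (pderiv p)) x) + (poly p x)\<^sup>2"
    by (simp add: pderiv_mult pderiv_pCons pderiv_add pderiv_diff pderiv_smult algebra_simps power2_eq_square)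
  moreover have "\<dots> \<ge> 0" using linear.IH by (intro add_nonneg_nonneg mult_nonneg_nonneg) auto
  ultimately show ?case by linarith
qed (simp add: pderiv_pCons)

text \<open>Newton's inequality for the Taylor coefficients of \<open>e\<^sup>a\<^sup>X p\<close>; it is the
  Laguerre inequality at \<open>0\<close> for the derivatives, which have the form \<open>e\<^sup>a\<^sup>X (D + a)\<^sup>j p\<close>.\<close>
lemma real_split_Newton:
  fixes p :: "real poly"
  assumes "real_split p" "a \<noteq> 0"
  defines "c \<equiv> fps_nth (fps_exp a * fps_of_poly p)"
  shows   "real (j + 2) * (c j * c (j + 2)) \<le> real (j + 1) * (c (j + 1))\<^sup>2"
proof -
  define T where "T = (\<lambda>p::real poly. pderiv p + smult a p)"
  have T: "fps_deriv (fps_exp a * fps_of_poly q) = fps_exp a * fps_of_poly (T q)" for q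
    by (simp add: T_def fps_of_poly_pderiv fps_of_poly_add fps_of_poly_smult algebra_simps)
  have TT: "(fps_deriv ^^ n) (fps_exp a * fps_of_poly q) = fps_exp a * fps_of_poly ((T ^^ n) q)" for q n
    by (induction n) (simp_all only: funpow.simps id_apply o_apply T)
  have fc: "fact n * c n = poly ((T ^^ n) p) 0" for n
    using fps_0th_higher_deriv[of n "fps_exp a * fps_of_poly p"]
    by (simp add: TT c_def poly_0_coeff_0)
  define q where "q = (T ^^ j) p"
  have rs: "real_split q"
    unfolding q_def by (induction j) (use assms real_split_deriv_shift in \<open>auto simp: T_def\<close>)
  have q1: "poly ((T ^^ (j + 1)) p) 0 = poly (pderiv q) 0 + a * poly q 0"
    by (simp add: q_def[symmetric]) (simp add: T_def)
  have q2: "poly ((T ^^ (j + 2)) p) 0 = poly (pderiv (pderiv q)) 0 + 2 * a * poly (pderiv q) 0 + a\<^sup>2 * poly q 0"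
    by (simp add: q_def[symmetric]) 
       (simp add: T_def pderiv_add pderiv_smult algebra_simps power2_eq_square)
  \<comment> \<open>All terms with \<open>a\<close> cancel: replacing \<open>q'\<close> by
    \<open>q' + a q\<close> and \<open>q''\<close> by \<open>q'' + 2 a q' + a^2 q\<close> leaves
    \<open>q'^2 - q q''\<close> unchanged.\<close>
  have "(fact j * c j) * (fact (j + 2) * c (j + 2)) \<le> (fact (j + 1) * c (j + 1))\<^sup>2"
    unfolding fc q1 q2 q_def[symmetric]
    using real_split_Laguerre[OF rs, of 0] by (simp add: algebra_simps power2_eq_square)
  also have "(fact j * c j) * (fact (j + 2) * c (j + 2)) = (fact j)\<^sup>2 * real (j + 1) * (real (j + 2) * (c j * c (j + 2)))"
    by (simp add: power2_eq_square algebra_simps)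
  also have "(fact (j + 1) * c (j + 1))\<^sup>2 = (fact j)\<^sup>2 * real (j + 1) * (real (j + 1) * (c (j + 1))\<^sup>2)"
    by (simp add: power2_eq_square algebra_simps)
  finally show ?thesis
    by (subst (asm) mult_le_cancel_left_pos) auto
qed

lemma fps_linear_factor_nth:
  fixes g :: "'a::comm_ring_1 fps"
  shows "((1 - fps_const s * fps_X) * g) $ Suc n = g $ Suc n - s * g $ n"
  by (simp add: left_diff_distrib mult.assoc)

text \<open>Division by the linear factor is multiplication by the geometric series in
  \<open>s X\<close>.\<close>

lemma fps_linear_quotient_nth:
  fixes g :: "'a::comm_ring_1 fps"
  shows "g $ n = (\<Sum>m\<le>n. s ^ m * ((1 - fps_const s * fps_X) * g) $ (n - m))"
proof (induction n)
  case (Suc n)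
  have "(\<Sum>m\<le>Suc n. s ^ m * ((1 - fps_const s * fps_X) * g) $ (Suc n - m)) =
    ((1 - fps_const s * fps_X) * g) $ Suc n + s * (\<Sum>m\<le>n. s ^ m * ((1 - fps_const s * fps_X) * g) $ (n - m))"
    by (subst sum.atMost_Suc_shift) (simp add: sum_distrib_left mult.assoc)
  also have "\<dots> = g $ Suc n" using Suc.IH by (simp add: fps_linear_factor_nth)
  finally show ?case by simp
qed (simp add: left_diff_distrib)

text \<open>Dividing out one of the factors \<open>1 - s\<^sub>i X\<close> of a series with two consecutive vanishing coefficients
  leaves three consecutive coefficients in geometric progression, which Newton's inequality only
  allows if they vanish. So a nonzero polynomial would have all the \<open>s\<^sub>i\<close> as roots.\<close>
lemma no_two_consecutive_zero_coeffs:
  fixes E :: "real fps" and p :: "nat \<Rightarrow> real poly" and s :: "nat \<Rightarrow> real"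
  assumes lim: "\<And>k. (\<lambda>n. coeff (p n) k) \<longlonglongrightarrow> E $ k" and E0: "E $ 0 = 1"
  assumes s: "inj s" "\<And>i. s i \<noteq> 0" and a: "a \<noteq> 0"
  assumes split: "\<And>i. eventually (\<lambda>n. \<exists>q. real_split q \<and> p n = [:1, - s i:] * q) sequentially"
  shows   "\<not> ((fps_exp a * E) $ k = 0 \<and> (fps_exp a * E) $ Suc k = 0)"
proof
  define f where "f = fps_exp a * E"
  assume "(fps_exp a * E) $ k = 0 \<and> (fps_exp a * E) $ Suc k = 0"
  hence fk: "f $ k = 0" "f $ Suc k = 0" by (auto simp: f_def)
  have f0: "f $ 0 = 1" using E0 by (simp add: f_def)
  with fk obtain j where j: "k = Suc j" by (cases k) auto
  \<comment> \<open>Coefficients of \<open>f / (1 - s i X)\<close>. For the approximants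
    \<open>p N\<close> this quotient is \<open>fps_exp a\<close> times a real-rooted polynomial, so
    Newton's inequality passes to the limit.\<close>
  define g where "g = (\<lambda>i n. \<Sum>m\<le>n. s i ^ m * f $ (n - m))"
  have lin: "g i (Suc n) = f $ Suc n + s i * g i n" for i n
    unfolding g_def by (subst sum.atMost_Suc_shift) (simp add: sum_distrib_left mult.assoc)
  have Newton: "real (j + 2) * (g i j * g i (j + 2)) \<le> real (j + 1) * (g i (j + 1))\<^sup>2" for i
  proof -
    define G where "G = (\<lambda>N n. \<Sum>m\<le>n. s i ^ m * (fps_exp a * fps_of_poly (p N)) $ (n - m))"
    have limG: "(\<lambda>N. G N n) \<longlonglongrightarrow> g i n" for n
      unfolding G_def g_def f_def fps_mult_nth fps_of_poly_nth
      by (intro tendsto_sum tendsto_mult tendsto_const lim)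
    have "eventually (\<lambda>N. real (j + 2) * (G N j * G N (j + 2)) \<le> real (j + 1) * (G N (j + 1))\<^sup>2) sequentially"
      using split[of i]
    proof eventually_elim
      case (elim N)
      then obtain q where q: "real_split q" "p N = [:1, - s i:] * q" by auto
      have "fps_of_poly [:1, - s i:] = 1 - fps_const (s i) * fps_X"
        by (simp add: fps_of_poly_pCons)
      hence eq: "fps_exp a * fps_of_poly (p N) = (1 - fps_const (s i) * fps_X) * (fps_exp a * fps_of_poly q)"
        by (simp add: q fps_of_poly_mult mult_ac)
      have "G N = (\<lambda>n. (fps_exp a * fps_of_poly q) $ n)"
        by (simp only: G_def eq fps_linear_quotient_nth[symmetric])
      thus ?case using real_split_Newton[OF q(1) a, of j] by simp
    qed
    thus ?thesis
      by (intro tendsto_le[OF _ _ _ ]) (auto intro!: tendsto_intros limG)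
  qed
  have g0: "g i j = 0" for i
  proof -
    have "g i (j + 1) = s i * g i j" "g i (j + 2) = s i * (s i * g i j)"
      using lin[of i j] lin[of i "Suc j"] fk j by auto
    \<comment> \<open>With \<open>v = s i * g i j\<close> both sides are multiples of
      \<open>v^2\<close>, and the larger factor stands on the left, so \<open>v = 0\<close>.\<close>
    hence "real (j + 2) * (s i * g i j)\<^sup>2 \<le> real (j + 1) * (s i * g i j)\<^sup>2"
      using Newton[of i] by (simp add: power2_eq_square algebra_simps)
    hence "(s i * g i j)\<^sup>2 \<le> 0" by (simp add: algebra_simps)
    thus ?thesis using s by simp
  qed
  \<comment> \<open>\<open>g i j\<close> is the value at \<open>s i\<close> of a polynomial with
    leading coefficient \<open>f $ 0 = 1\<close>, which cannot have infinitely many roots.\<close>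
  define P where "P = (\<Sum>m\<le>j. monom (f $ (j - m)) m)"
  have "poly P (s i) = 0" for i
    using g0[of i] by (simp add: P_def g_def poly_sum poly_monom mult.commute)
  hence "range s \<subseteq> {x. poly P x = 0}" by auto
  moreover have "coeff P j = 1" by (simp add: P_def coeff_sum f0)
  hence "P \<noteq> 0" by auto
  hence "finite {x. poly P x = 0}" by (rule poly_roots_finite)
  ultimately have "finite (range s)" by (rule finite_subset)
  thus False using s(1) by (simp add: finite_image_iff)
qed

section \<open>Appell polynomials and the choice of a generic pair of zeros\<close>

definition Appell :: "real fps \<Rightarrow> nat \<Rightarrow> real poly" where
  "Appell E k = (\<Sum>j\<le>k. monom (E $ (k - j) / fact j) j)"

lemma poly_Appell: "poly (Appell E k) a = (fps_exp a * E) $ k"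
  unfolding Appell_def poly_sum poly_monom fps_mult_nth atMost_atLeast0
  by (intro sum.cong) simp_all

lemma coeff_Appell: "coeff (Appell E k) j = (if j \<le> k then E $ (k - j) / fact j else 0)"
  by (simp add: Appell_def coeff_sum)

lemma degree_Appell: "E $ 0 = 1 \<Longrightarrow> degree (Appell E k) = k"
  by (intro antisym degree_le le_degree) (auto simp: coeff_Appell)

text \<open>Hence the ratios \<open>B_(k+1) / B_k\<close> and \<open>B_(l+1) / B_l\<close> agree at
  finitely many points only. Both products have degree \<open>k + l + 1\<close>, but their leading
  coefficients differ by the factor \<open>(l + 1) / (k + 1)\<close>.\<close>

lemma Appell_Wronskian_nonzero:
  assumes "E $ 0 = 1" "k < l"
  shows   "Appell E (Suc k) * Appell E l - Appell E (Suc l) * Appell E k \<noteq> 0"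
proof
  let ?A = "Appell E"
  assume eq: "?A (Suc k) * ?A l - ?A (Suc l) * ?A k = 0"
  have "coeff (?A (Suc k) * ?A l) (Suc k + l) = 1 / (fact (Suc k) * fact l)"
    using coeff_mult_degree_sum[of "?A (Suc k)" "?A l"] assms(1) by (simp add: degree_Appell coeff_Appell)
  moreover have "coeff (?A (Suc l) * ?A k) (Suc k + l) = 1 / (fact (Suc l) * fact k)"
    using coeff_mult_degree_sum[of "?A (Suc l)" "?A k"] assms(1)
    by (simp add: degree_Appell coeff_Appell add.commute)
  ultimately have "1 / (fact (Suc k) * fact l) = (1 / (fact (Suc l) * fact k) :: real)"
    using eq by (metis coeff_diff coeff_0 eq_iff_diff_eq_0)
  hence "real (Suc l) = real (Suc k)"
    by (simp add: field_simps)
  thus False using assms by simp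
qed

text \<open>The coefficient of \<open>X\<^sup>k\<close> in \<open>e\<^sup>a\<^sup>X (1 - tX) E\<close> is \<open>B\<^sub>k(a) - t B\<^sub>k\<^sub>-\<^sub>1(a)\<close> with the Appell polynomials
  \<open>B\<^sub>k\<close>. If two of them vanish, then \<open>a\<close> is a root of a nonzero Wronskian and
  \<open>t = B\<^sub>k(a) / B\<^sub>k\<^sub>-\<^sub>1(a)\<close>, so there are only countably many exceptional \<open>t\<close>.\<close>
lemma exists_generic_factor:
  fixes E :: "real fps"
  assumes E0: "E $ 0 = 1"
  assumes nz: "\<And>a k. a < 0 \<Longrightarrow> \<not> ((fps_exp a * E) $ k = 0 \<and> (fps_exp a * E) $ Suc k = 0)"
  obtains t where "0 < t" "t < 1"
    "\<And>a k l. a < 0 \<Longrightarrow> (fps_exp a * ((1 - fps_const t * fps_X) * E)) $ k = 0 \<Longrightarrow>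
       (fps_exp a * ((1 - fps_const t * fps_X) * E)) $ l = 0 \<Longrightarrow> k = l"
proof -
  let ?A = "Appell E"
  define W where "W = (\<lambda>k l. ?A (Suc k) * ?A l - ?A (Suc l) * ?A k)"
  define bad where "bad = (\<Union>k. \<Union>l\<in>{k<..}. (\<lambda>a. poly (?A (Suc k)) a / poly (?A k) a) ` {a. poly (W k l) a = 0})"
  have "countable {a. poly (W k l) a = 0}" if "k < l" for k l
    unfolding W_def by (intro countable_finite poly_roots_finite Appell_Wronskian_nonzero E0 that)
  hence "countable bad"
    unfolding bad_def by (intro countable_UN countable_image countableI_type) auto
  hence "\<not> {0<..<1} \<subseteq> bad"
    using countable_subset uncountable_open_interval[of 0 "1::real"] by auto
  then obtain t where t: "0 < t" "t < 1" "t \<notin> bad"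
    unfolding subset_eq by auto
  have nth: "(fps_exp a * ((1 - fps_const t * fps_X) * E)) $ Suc k = poly (?A (Suc k)) a - t * poly (?A k) a" for a k
    using fps_linear_factor_nth[of t "fps_exp a * E" k] by (simp add: poly_Appell mult_ac)
  have *: False if "a < 0" "k < l" "(fps_exp a * ((1 - fps_const t * fps_X) * E)) $ k = 0"
      "(fps_exp a * ((1 - fps_const t * fps_X) * E)) $ l = 0" for a k l
  proof -
    \<comment> \<open>The constant coefficient is 1, so a vanishing coefficient has positive
      index.\<close>
    have "k \<noteq> 0" using that(3) E0 by (intro notI) simp
    then obtain k' l' where k': "k = Suc k'" "l = Suc l'" "k' < l'"
      using \<open>k < l\<close> by (metis Suc_lessE lessE not0_implies_Suc Suc_less_eq)
    have k: "poly (?A (Suc k')) a = t * poly (?A k') a"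
      using that(3) unfolding k' nth by simp
    have l: "poly (?A (Suc l')) a = t * poly (?A l') a"
      using that(4) unfolding k' nth by simp
    \<comment> \<open>Otherwise the equation \<open>k\<close> would make two consecutive
      coefficients vanish, contrary to \<open>nz\<close>.\<close>
    have "poly (?A k') a \<noteq> 0" using nz[OF that(1), of k'] k by (auto simp: poly_Appell)
    hence "t = poly (?A (Suc k')) a / poly (?A k') a" using k by simp
    moreover have "poly (W k' l') a = 0" by (simp add: W_def k l)
    ultimately have "t \<in> bad" unfolding bad_def using k' by blast
    thus False using t by simp
  qed
  show ?thesis
  proof (rule that[OF t(1,2)])
    fix a :: real and k l :: nat
    assume "a < 0" "(fps_exp a * ((1 - fps_const t * fps_X) * E)) $ k = 0"
      "(fps_exp a * ((1 - fps_const t * fps_X) * E)) $ l = 0"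
    with *[of a k l] *[of a l k] show "k = l" by (cases k l rule: linorder_cases) auto
  qed
qed

section \<open>Even and odd parts of the finite products\<close>

text \<open>Encodes a series by its even and odd parts: an even factor acts on both parts
  separately, a linear factor mixes them.\<close>

definition weave :: "'a::comm_ring_1 fps \<Rightarrow> 'a fps \<Rightarrow> 'a fps" where
  "weave E D = (E oo fps_X ^ 2) + fps_X * (D oo fps_X ^ 2)"

lemma weave_nth_even: "weave E D $ (2 * k) = E $ k"
proof -
  have "odd (2 * k - 1)" if "k \<noteq> 0" using that by (cases k) auto
  thus ?thesis by (auto simp: weave_def fps_nth_compose_X_power)
qed

lemma weave_decomp: "F = weave (Abs_fps (\<lambda>k. F $ (2 * k))) (Abs_fps (\<lambda>k. F $ (2 * k + 1)))"
proof (rule fps_ext)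
  fix n
  show "F $ n = weave (Abs_fps (\<lambda>k. F $ (2 * k))) (Abs_fps (\<lambda>k. F $ (2 * k + 1))) $ n"
    by (cases "even n"; cases n) (auto simp: weave_def fps_nth_compose_X_power elim!: oddE evenE)
qed

lemma compose_square_mult:
  fixes A B :: "'a::idom fps"
  shows "(A * B) oo fps_X ^ 2 = (A oo fps_X ^ 2) * (B oo fps_X ^ 2)"
  by (rule fps_compose_mult_distrib) simp

lemma weave_mult_even:
  fixes A :: "'a::idom fps"
  shows "(A oo fps_X ^ 2) * weave E D = weave (A * E) (A * D)"
  by (simp add: weave_def compose_square_mult algebra_simps)

lemma weave_mult_linear:
  fixes E :: "'a::idom fps"
  shows "(1 - fps_const c * fps_X) * weave E D = weave (E - fps_const c * fps_X * D) (D - fps_const c * E)"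
proof -
  have c: "fps_const c oo fps_X ^ 2 = fps_const c" and X: "fps_X oo fps_X ^ 2 = (fps_X ^ 2 :: 'a fps)"
    by (simp_all add: fps_X_fps_compose_startby0)
  show ?thesis
    unfolding weave_def fps_compose_sub_distrib compose_square_mult c X
    by (simp add: algebra_simps power2_eq_square)
qed

lemma weave_mult_linear_add:
  fixes E :: "'a::idom fps"
  shows "(1 + fps_const c * fps_X) * weave E D = weave (E + fps_const c * fps_X * D) (D + fps_const c * E)"
proof -
  have c: "fps_const c oo fps_X ^ 2 = fps_const c" and X: "fps_X oo fps_X ^ 2 = (fps_X ^ 2 :: 'a fps)"
    by (simp_all add: fps_X_fps_compose_startby0)
  show ?thesis
    unfolding weave_def fps_compose_add_distrib compose_square_mult c X
    by (simp add: algebra_simps power2_eq_square)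
qed

text \<open>The pair \<open>(E, D)\<close> with
  \<open>(1 - z) (1 - z/2) ... (1 - z/2^(n-1)) = E(z^2) + z D(z^2)\<close>.\<close>

primrec parity_parts :: "nat \<Rightarrow> real poly \<times> real poly" where
  "parity_parts 0 = (1, 0)"
| "parity_parts (Suc n) = (fst (parity_parts n) - smult (1 / 2 ^ n) (pCons 0 (snd (parity_parts n))), snd (parity_parts n) - smult (1 / 2 ^ n) (fst (parity_parts n)))"

lemma cpoly_diff: "cpoly (p - q) = cpoly p - cpoly q"
  by (rule poly_eqI) (simp add: coeff_map_poly)

lemma parity_parts_0: "poly (fst (parity_parts n)) 0 = 1"
  by (induction n) auto

text \<open>In the style of the Hermite--Biehler theorem: \<open>Im (D / E) \<ge> 0 \<ge> Im (w D / E)\<close> in the upper half plane,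
  where \<open>E(z\<^sup>2) + z D(z\<^sup>2)\<close> has only positive zeros.\<close>
lemma parity_parts_Im:
  assumes "Im w \<noteq> 0"
  defines "E \<equiv> (\<lambda>n. poly (cpoly (fst (parity_parts n))) w)" and "D \<equiv> (\<lambda>n. poly (cpoly (snd (parity_parts n))) w)"
  shows "Im w * Im (D n * cnj (E n)) \<ge> 0 \<and> Im w * Im (w * D n * cnj (E n)) \<le> 0 \<and>
         (n > 0 \<longrightarrow> Im w * Im (w * D n * cnj (E n)) < 0)"
proof (induction n)
  case 0
  thus ?case by (simp add: E_def D_def)
next
  case (Suc n)
  define c :: real where "c = 1 / 2 ^ n"
  have c: "c > 0" by (simp add: c_def)
  from Suc.IH have IH1: "Im w * Im (D n * cnj (E n)) \<ge> 0" and IH2: "- (Im w * Im (w * D n * cnj (E n))) \<ge> 0"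
    by linarith+
  have E': "E (Suc n) = E n - of_real c * w * D n" and D': "D (Suc n) = D n - of_real c * E n"
    by (simp_all add: E_def D_def cpoly_diff cpoly_smult cpoly_pCons c_def)
  have X: "Im w * Im (D (Suc n) * cnj (E (Suc n))) =
     Im w * Im (D n * cnj (E n)) + c * (Im w)\<^sup>2 * (norm (D n))\<^sup>2 + c\<^sup>2 * (- (Im w * Im (w * D n * cnj (E n))))"
    unfolding E' D' cmod_power2 by (simp add: algebra_simps power2_eq_square)
  have Y: "Im w * Im (w * D (Suc n) * cnj (E (Suc n))) =
     Im w * Im (w * D n * cnj (E n)) - c * (Im w)\<^sup>2 * (norm (E n))\<^sup>2 - c\<^sup>2 * (norm w)\<^sup>2 * (Im w * Im (D n * cnj (E n)))"
    unfolding E' D' cmod_power2 by (simp add: algebra_simps power2_eq_square)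
  \<comment> \<open>Strictness starts at \<open>n = 0\<close>, where \<open>D 0 = 0\<close> and
    \<open>E 0 = 1\<close> make the subtracted term positive; afterwards it is inherited.\<close>
  have "Im w * Im (w * D n * cnj (E n)) - c * (Im w)\<^sup>2 * (norm (E n))\<^sup>2 < 0"
  proof (cases "n = 0")
    case True
    thus ?thesis using c assms(1) by (simp add: E_def D_def)
  next
    case False
    have "c * (Im w)\<^sup>2 * (norm (E n))\<^sup>2 \<ge> 0" using c by simp
    with Suc False show ?thesis by linarith
  qed
  moreover have "c\<^sup>2 * (norm w)\<^sup>2 * (Im w * Im (D n * cnj (E n))) \<ge> 0"
    by (rule mult_nonneg_nonneg[OF _ IH1]) simp
  ultimately have "Im w * Im (w * D (Suc n) * cnj (E (Suc n))) < 0" unfolding Y by linarith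
  moreover have "Im w * Im (D (Suc n) * cnj (E (Suc n))) \<ge> 0"
    unfolding X using c IH2 by (intro add_nonneg_nonneg mult_nonneg_nonneg IH1) simp_all
  ultimately show ?case by simp
qed

text \<open>The parts after the further factor \<open>1 + 2 z\<close>, which belongs to the negative
  zero \<open>-1/2\<close>.\<close>

definition even_part :: "nat \<Rightarrow> real poly" where
  "even_part n = fst (parity_parts n) + smult 2 (pCons 0 (snd (parity_parts n)))"

definition odd_part :: "nat \<Rightarrow> real poly" where
  "odd_part n = snd (parity_parts n) + smult 2 (fst (parity_parts n))"

text \<open>At a root \<open>E = -2 w D\<close>, so \<open>w D cnj E\<close> would be the real
  number \<open>-2 |w D|^2\<close>. This contradicts the strict inequality of
  \<open>parity_parts_Im\<close> for \<open>n > 0\<close>, and for \<open>n = 0\<close> the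
  polynomial is 1.\<close>

lemma even_part_root_real:
  assumes "Im w \<noteq> 0"
  shows   "poly (cpoly (even_part n)) w \<noteq> 0"
proof
  define E where "E = poly (cpoly (fst (parity_parts n))) w"
  define D where "D = poly (cpoly (snd (parity_parts n))) w"
  assume "poly (cpoly (even_part n)) w = 0"
  hence "E = - 2 * (w * D)" by (simp add: even_part_def cpoly_simps E_def D_def add_eq_0_iff2 mult_ac)
  hence "w * D * cnj E = - 2 * ((w * D) * cnj (w * D))" by simp
  also have "Im \<dots> = 0" unfolding complex_norm_square[symmetric] by simp
  finally have "Im (w * D * cnj E) = 0" .
  hence "n = 0" using parity_parts_Im[OF assms, of n] by (auto simp: E_def D_def)
  thus False using \<open>E = - 2 * (w * D)\<close> by (simp add: E_def D_def)
qed

text \<open>In the variable \<open>w = z^2\<close>, the factors of the pairs of zeros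
  \<open>z = +-1 / sqrt (s j)\<close>.\<close>

definition symmetric_part :: "(nat \<Rightarrow> real) \<Rightarrow> nat set \<Rightarrow> real poly" where
  "symmetric_part s A = (\<Prod>j\<in>A. [:1, - s j:])"

lemma poly_symmetric_part: "poly (cpoly (symmetric_part s A)) w = (\<Prod>j\<in>A. 1 - of_real (s j) * w)"
proof -
  have "cpoly (symmetric_part s A) = (\<Prod>j\<in>A. [:1, - of_real (s j):])"
    unfolding symmetric_part_def by (induction A rule: infinite_finite_induct) (auto simp: cpoly_mult cpoly_pCons simp del: mult_pCons_left)
  thus ?thesis by (simp add: poly_prod mult.commute)
qed

lemma real_split_even_part: "finite A \<Longrightarrow> real_split (even_part n * symmetric_part s A)"
proof (rule real_splitI)
  assume "finite A"
  have "poly (even_part n * symmetric_part s A) 0 = 1"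
    by (simp add: even_part_def parity_parts_0 symmetric_part_def poly_prod)
  thus "even_part n * symmetric_part s A \<noteq> 0" by (metis poly_0 zero_neq_one)
  fix w assume w: "poly (cpoly (even_part n * symmetric_part s A)) w = 0"
  show "Im w = 0"
  proof (rule ccontr)
    assume Im: "Im w \<noteq> 0"
    then obtain j where j: "1 - of_real (s j) * w = 0"
      using w even_part_root_real[OF Im, of n] \<open>finite A\<close> by (auto simp: cpoly_mult poly_symmetric_part)
    hence "Im (of_real (s j) * w) = 0" by (metis eq_iff_diff_eq_0 one_complex.sel(2))
    with Im have "s j = 0" by simp
    with j show False by simp
  qed
qed

text \<open>The zeros \<open>-1/2\<close>, \<open>2^n\<close> and \<open>+-1 / sqrt (s n)\<close>
  for \<open>n < N\<close>, without the exponential factors, which disappear in the limit.\<close>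

definition partial_product :: "(nat \<Rightarrow> real) \<Rightarrow> nat \<Rightarrow> complex \<Rightarrow> complex" where
  "partial_product s N z = (1 + 2 * z) * (\<Prod>n<N. (1 - z / 2 ^ n) * (1 - of_real (s n) * z\<^sup>2))"

lemma partial_product_expansion:
  "partial_product s N has_fps_expansion
     weave (fps_of_poly (cpoly (even_part N * symmetric_part s {..<N}))) (fps_of_poly (cpoly (odd_part N * symmetric_part s {..<N})))"
proof -
  let ?c = "\<lambda>p. fps_of_poly (cpoly p)"
  have 1: "(\<lambda>z. \<Prod>n<N. 1 - z / 2 ^ n) has_fps_expansion weave (?c (fst (parity_parts N))) (?c (snd (parity_parts N)))"
  proof (induction N)
    case 0
    show ?case by (simp add: weave_def)
  next
    case (Suc N)
    have "(\<lambda>z::complex. 1 - 1 / 2 ^ N * z) has_fps_expansion 1 - fps_const (1 / 2 ^ N) * fps_X"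
      by (intro fps_expansion_intros)
    from has_fps_expansion_mult[OF this Suc] show ?case
      unfolding weave_mult_linear
      by (simp add: cpoly_diff cpoly_smult cpoly_pCons fps_of_poly_diff fps_of_poly_smult fps_of_poly_pCons mult_ac)
  qed
  have 2: "(\<lambda>z. \<Prod>n<N. 1 - of_real (s n) * z\<^sup>2) has_fps_expansion (?c (symmetric_part s {..<N}) oo fps_X ^ 2)"
  proof (induction N)
    case 0
    show ?case by (simp add: symmetric_part_def)
  next
    case (Suc N)
    have "(\<lambda>z::complex. 1 - of_real (s N) * z\<^sup>2) has_fps_expansion 1 - fps_const (of_real (s N)) * fps_X ^ 2"
      by (intro fps_expansion_intros)
    moreover have "1 - fps_const (of_real (s N)) * fps_X ^ 2 = ?c [:1, - s N:] oo fps_X ^ 2"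
      by (simp add: cpoly_pCons fps_of_poly_pCons fps_compose_add_distrib compose_square_mult fps_compose_uminus)
    ultimately have "(\<lambda>z. (1 - of_real (s N) * z\<^sup>2) * (\<Prod>n<N. 1 - of_real (s n) * z\<^sup>2)) has_fps_expansion
       (?c [:1, - s N:] oo fps_X ^ 2) * (?c (symmetric_part s {..<N}) oo fps_X ^ 2)"
      using Suc by (simp only: has_fps_expansion_mult)
    thus ?case
      by (simp add: symmetric_part_def cpoly_mult fps_of_poly_mult compose_square_mult mult_ac del: mult_pCons_left mult_pCons_right)
  qed
  have "(\<lambda>z::complex. 1 + 2 * z) has_fps_expansion 1 + fps_const 2 * fps_X"
    by (intro fps_expansion_intros)
  from has_fps_expansion_mult[OF 2 has_fps_expansion_mult[OF this 1]]
  have "(\<lambda>z. (\<Prod>n<N. 1 - of_real (s n) * z\<^sup>2) * ((1 + 2 * z) * (\<Prod>n<N. 1 - z / 2 ^ n))) has_fps_expansion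
     weave (?c (even_part N * symmetric_part s {..<N})) (?c (odd_part N * symmetric_part s {..<N}))"
    unfolding weave_mult_linear_add weave_mult_even
    by (simp add: even_part_def odd_part_def cpoly_simps fps_of_poly_mult fps_of_poly_add fps_of_poly_smult fps_of_poly_pCons algebra_simps)
  moreover have "(\<lambda>z. (\<Prod>n<N. 1 - of_real (s n) * z\<^sup>2) * ((1 + 2 * z) * (\<Prod>n<N. 1 - z / 2 ^ n))) = partial_product s N"
    by (simp add: fun_eq_iff partial_product_def prod.distrib mult_ac)
  ultimately show ?thesis by simp
qed

section \<open>The canonical product\<close>

text \<open>The Weierstrass product of genus 1. Square summability gives its convergence and also
  lets \<open>|x n|\<close> tend to infinity, because the terms \<open>(1 / x n)^2\<close> tend to
  0.\<close>

lemma canonical_product: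
  fixes x :: "nat \<Rightarrow> real"
  assumes x: "\<And>n. x n \<noteq> 0" and sum: "summable (\<lambda>n. (1 / x n)\<^sup>2)"
  obtains f where "f holomorphic_on UNIV"
    "\<And>z. (\<lambda>n. (1 - z / of_real (x n)) * exp (z / of_real (x n))) has_prod f z"
    "\<And>R. R > 0 \<Longrightarrow> uniform_limit (cball 0 R) (\<lambda>N z. \<Prod>n<N. (1 - z / of_real (x n)) * exp (z / of_real (x n))) f sequentially"
proof -
  define a where "a = (\<lambda>n. complex_of_real (x n))"
  have "(\<lambda>n. (1 / x n)\<^sup>2) \<longlonglongrightarrow> 0" using sum by (rule summable_LIMSEQ_zero)
  hence "(\<lambda>n. sqrt ((1 / x n)\<^sup>2)) \<longlonglongrightarrow> sqrt 0" by (rule tendsto_real_sqrt)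
  hence "(\<lambda>n. norm (inverse (a n))) \<longlonglongrightarrow> 0" by (simp add: a_def norm_divide inverse_eq_divide)
  hence "(\<lambda>n. inverse (a n)) \<longlonglongrightarrow> 0" by (rule tendsto_norm_zero_cancel)
  hence "filterlim (\<lambda>n. inverse (a n)) (at 0) sequentially"
    by (rule filterlim_atI) (use x in \<open>auto simp: a_def\<close>)
  from filterlim_compose[OF filterlim_inverse_at_infinity this]
  have inf: "filterlim a at_infinity sequentially" by simp
  interpret W: weierstrass_product a "\<lambda>_. 1"
  proof
    show "a n \<noteq> 0" for n using x by (simp add: a_def)
    show "filterlim a at_infinity sequentially" by (rule inf)
    fix r :: real assume "r > 0"
    have "(\<lambda>n. (r / norm (a n)) ^ Suc 1) = (\<lambda>n. r\<^sup>2 * (1 / x n)\<^sup>2)"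
      by (auto simp: a_def fun_eq_iff power_divide power2_eq_square)
    thus "summable (\<lambda>n. (r / norm (a n)) ^ Suc 1)" using sum by (simp only: summable_mult)
  qed
  have wf: "weierstrass_factor 1 (z / a n) = (1 - z / of_real (x n)) * exp (z / of_real (x n))" for z n
    by (simp add: weierstrass_factor_def a_def)
  show ?thesis
    using that[of W.f] W.holomorphic W.has_prod W.uniform_limit unfolding wf by blast
qed

text \<open>After \<open>-1/2\<close> come blocks of three, \<open>2^n\<close> and a pair
  \<open>+-1 / sqrt (s n)\<close>, so that the exponentials of a pair cancel within its
  block.\<close>

definition zeros :: "(nat \<Rightarrow> real) \<Rightarrow> nat \<Rightarrow> real" where
  "zeros s k = (if k = 0 then - 1 / 2
     else if (k - 1) mod 3 = 0 then 2 ^ ((k - 1) div 3)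
     else if (k - 1) mod 3 = 1 then 1 / sqrt (s ((k - 1) div 3)) else - 1 / sqrt (s ((k - 1) div 3)))"

lemma zeros_simps:
  "zeros s 0 = - 1 / 2" "zeros s (Suc (3 * n)) = 2 ^ n"
  "zeros s (Suc (Suc (3 * n))) = 1 / sqrt (s n)" "zeros s (Suc (Suc (Suc (3 * n)))) = - 1 / sqrt (s n)"
proof -
  have "Suc (3 * n) div 3 = n" "Suc (3 * n) mod 3 = 1" "Suc (Suc (3 * n)) div 3 = n" "Suc (Suc (3 * n)) mod 3 = 2"
    by presburger+
  thus "zeros s 0 = - 1 / 2" "zeros s (Suc (3 * n)) = 2 ^ n"
    "zeros s (Suc (Suc (3 * n))) = 1 / sqrt (s n)" "zeros s (Suc (Suc (Suc (3 * n)))) = - 1 / sqrt (s n)"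
    by (simp_all add: zeros_def)
qed

text \<open>The generic pair is put in front and leaves \<open>zeros s\<close> intact, so that
  \<open>t\<close> can be chosen after the remaining product is known.\<close>

definition zeros' :: "real \<Rightarrow> (nat \<Rightarrow> real) \<Rightarrow> nat \<Rightarrow> real" where
  "zeros' t s k = (if k = 0 then 1 / sqrt t else if k = 1 then - 1 / sqrt t else zeros s (k - 2))"

lemma zeros_nonzero: "(\<And>n. s n > 0) \<Longrightarrow> zeros s k \<noteq> 0"
  by (auto simp: zeros_def less_imp_neq[symmetric])

lemma summable_zeros:
  assumes s: "\<And>n. s n > 0" "summable s"
  shows   "summable (\<lambda>k. (1 / zeros s k)\<^sup>2)"
proof (rule summableI_nonneg_bounded)
  have geo: "summable (\<lambda>n. (1 / 4) ^ n :: real)" by (rule summable_geometric) simp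
  show "(\<Sum>k<n. (1 / zeros s k)\<^sup>2) \<le> 4 + (\<Sum>n. (1 / 4) ^ n) + 2 * suminf s" for n
  proof -
    have sq: "(1 / (1 / sqrt (s n)))\<^sup>2 = s n" "(1 / (- 1 / sqrt (s n)))\<^sup>2 = s n" for n
      using s(1)[of n] by auto
    have p4: "(1 / 2 ^ n)\<^sup>2 = ((1 / 4) ^ n :: real)" for n
      by (simp add: power2_eq_square power_divide flip: power_mult_distrib)
    \<comment> \<open>At the end of a block, \<open>-1/2\<close> has contributed 4, the powers of
      two a geometric sum and each pair \<open>2 * s i\<close>.\<close>
    have eq: "(\<Sum>k<Suc (3 * n). (1 / zeros s k)\<^sup>2) = 4 + (\<Sum>i<n. (1 / 4) ^ i) + 2 * (\<Sum>i<n. s i)" for n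
    proof (induction n)
      case (Suc n)
      have "Suc (3 * Suc n) = Suc (Suc (Suc (Suc (3 * n))))" by simp
      thus ?case using Suc by (simp only: sum.lessThan_Suc zeros_simps sq p4) simp
    qed (simp add: zeros_simps power2_eq_square)
    have "(\<Sum>k<n. (1 / zeros s k)\<^sup>2) \<le> (\<Sum>k<Suc (3 * n). (1 / zeros s k)\<^sup>2)"
      by (intro sum_mono2) auto
    also have "\<dots> \<le> 4 + (\<Sum>n. (1 / 4) ^ n) + 2 * suminf s"
      unfolding eq by (intro add_mono mult_left_mono sum_le_suminf geo s order_refl) (use s in \<open>auto intro: less_imp_le\<close>)
    finally show ?thesis .
  qed
qed auto

text \<open>The negative zero \<open>-1/2\<close> cancels the exponential factors of all the zeros \<open>2\<^sup>n\<close>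
  in the limit, since \<open>\<Sum> 2\<^sup>-\<^sup>n = 2\<close>.\<close>
lemma partial_products_zeros:
  assumes s: "\<And>n. s n > 0"
  shows "(\<Prod>k<Suc (3 * N). (1 - z / of_real (zeros s k)) * exp (z / of_real (zeros s k))) =
         partial_product s N z * exp (- 2 * z / 2 ^ N)"
proof (induction N)
  case 0
  show ?case by (simp add: zeros_simps partial_product_def mult.commute)
next
  case (Suc N)
  define u where "u = complex_of_real (sqrt (s N))"
  have u2: "u * u = of_real (s N)" using s[of N] by (simp add: u_def flip: of_real_mult)
  have q: "z / of_real (1 / sqrt (s N)) = z * u" "z / of_real (- 1 / sqrt (s N)) = - (z * u)"
    by (simp_all add: u_def)
  \<comment> \<open>The exponentials of the pair cancel, and the zero \<open>2^N\<close> halves the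
    remaining exponent.\<close>
  have 1: "exp (- 2 * z / 2 ^ N) * exp (z / 2 ^ N) * (exp (z * u) * exp (- (z * u))) = exp (- 2 * z / 2 ^ Suc N)"
    by (simp add: exp_add[symmetric] field_simps)
  have 2: "(1 - z * u) * (1 + z * u) = 1 - of_real (s N) * z\<^sup>2"
    by (simp add: algebra_simps power2_eq_square flip: u2)
  have three: "Suc (3 * Suc N) = Suc (Suc (Suc (Suc (3 * N))))" by simp
  have "(\<Prod>k<Suc (3 * Suc N). (1 - z / of_real (zeros s k)) * exp (z / of_real (zeros s k))) =
     partial_product s N z * exp (- 2 * z / 2 ^ N) * ((1 - z / 2 ^ N) * exp (z / 2 ^ N)) *
     ((1 - z * u) * exp (z * u)) * ((1 + z * u) * exp (- (z * u)))"
    unfolding three prod.lessThan_Suc[of _ "Suc _"] Suc zeros_simps q by simp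
  also have "\<dots> = partial_product s N z * (1 - z / 2 ^ N) * ((1 - z * u) * (1 + z * u)) *
     (exp (- 2 * z / 2 ^ N) * exp (z / 2 ^ N) * (exp (z * u) * exp (- (z * u))))"
    by (simp only: mult_ac)
  finally show ?case
    unfolding 1 2 by (simp add: partial_product_def mult_ac)
qed

lemma uniform_limit_exp_to_1:
  "uniform_limit (cball 0 R) (\<lambda>N z. exp (2 * z / 2 ^ N :: complex)) (\<lambda>_. 1) sequentially"
proof (rule uniform_limitI)
  fix e :: real assume e: "e > 0"
  have "(\<lambda>N. 2 * R / 2 ^ N) \<longlonglongrightarrow> 0" by real_asymp
  hence "\<forall>\<^sub>F N in sequentially. 2 * R / 2 ^ N < min (1 / 2) (e / 2)"
    using e by (intro order_tendstoD) auto
  thus "\<forall>\<^sub>F N in sequentially. \<forall>z\<in>cball 0 R. dist (exp (2 * z / 2 ^ N :: complex)) 1 < e"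
  proof eventually_elim
    case (elim N)
    show ?case
    proof
      fix z :: complex assume "z \<in> cball 0 R"
      hence "norm (2 * z / 2 ^ N) \<le> 2 * R / 2 ^ N"
        by (simp add: norm_mult norm_divide norm_power divide_right_mono)
      with elim have le: "norm (2 * z / 2 ^ N) \<le> 1 / 2" "norm (2 * z / 2 ^ N) < e / 2"
        unfolding min_less_iff_conj by linarith+
      have "norm (exp (2 * z / 2 ^ N) - 1) \<le> 3 / 2 * norm (2 * z / 2 ^ N)"
        using le(1) by (rule norm_exp_bounds)
      thus "dist (exp (2 * z / 2 ^ N :: complex)) 1 < e"
        using le(2) norm_ge_zero[of "2 * z / 2 ^ N"] unfolding dist_norm by linarith
    qed
  qed
qed

lemma zeros'_nonzero: "t > 0 \<Longrightarrow> (\<And>n. s n > 0) \<Longrightarrow> zeros' t s k \<noteq> 0"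
  using zeros_nonzero[of s] by (auto simp: zeros'_def)

lemma summable_zeros':
  assumes s: "\<And>n. s n > 0" "summable s"
  shows   "summable (\<lambda>k. (1 / zeros' t s k)\<^sup>2)"
proof -
  have shift: "zeros' t s (n + 2) = zeros s n" for n by (simp add: zeros'_def)
  have "summable (\<lambda>n. (1 / zeros' t s (n + 2))\<^sup>2)"
    unfolding shift by (rule summable_zeros[OF s])
  thus ?thesis by (subst (asm) summable_iff_shift)
qed

text \<open>\<open>f\<close> is the product over \<open>zeros s\<close> and does not depend on
  \<open>t\<close>. For each \<open>t\<close> the canonical product over \<open>zeros' t s\<close>
  is identified by comparing partial products, shifted by the two extra factors.\<close>

lemma base_function:
  assumes s: "\<And>n. s n > 0" "summable s"
  obtains f where "f holomorphic_on UNIV"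
    "\<And>R. R > 0 \<Longrightarrow> uniform_limit (cball 0 R) (partial_product s) f sequentially"
    "\<And>t z. t > 0 \<Longrightarrow> (\<lambda>n. (1 - z / of_real (zeros' t s n)) * exp (z / of_real (zeros' t s n)))
                       has_prod ((1 - of_real t * z\<^sup>2) * f z)"
proof -
  obtain f where f: "f holomorphic_on UNIV"
    "\<And>R. R > 0 \<Longrightarrow> uniform_limit (cball 0 R) (\<lambda>N z. \<Prod>n<N. (1 - z / of_real (zeros s n)) * exp (z / of_real (zeros s n))) f sequentially"
    by (rule canonical_product[of "zeros s"]) (use s zeros_nonzero summable_zeros in auto)
  have ul: "uniform_limit (cball 0 R) (partial_product s) f sequentially" if "R > 0" for R
  proof -
    \<comment> \<open>The closed form is available for the partial products that end with a complete
      block.\<close>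
    have "filterlim (\<lambda>N. Suc (3 * N)) at_top sequentially"
      by (intro filterlim_subseq strict_monoI) simp
    from filterlim_compose[OF f(2)[OF that] this]
    have 1: "uniform_limit (cball 0 R) (\<lambda>N z. partial_product s N z * exp (- 2 * z / 2 ^ N)) f sequentially"
      unfolding partial_products_zeros[OF s(1)] .
    have "bounded (f ` cball 0 R)"
      by (intro compact_imp_bounded compact_continuous_image holomorphic_on_imp_continuous_on
            holomorphic_on_subset[OF f(1)]) auto
    \<comment> \<open>The new factor removes the residual exponential and tends to 1; boundedness of
      \<open>f\<close> makes the convergence of the product uniform.\<close>
    hence "uniform_limit (cball 0 R) (\<lambda>N z. (partial_product s N z * exp (- 2 * z / 2 ^ N)) * exp (2 * z / 2 ^ N)) (\<lambda>z. f z * 1) sequentially"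
      by (intro uniform_lim_mult 1 uniform_limit_exp_to_1) (auto simp: image_constant_conv)
    thus ?thesis by (simp add: mult.assoc flip: exp_add)
  qed
  have hp: "(\<lambda>n. (1 - z / of_real (zeros' t s n)) * exp (z / of_real (zeros' t s n)))
                       has_prod ((1 - of_real t * z\<^sup>2) * f z)" if t: "t > 0" for t z
  proof -
    obtain g where g:
      "\<And>z. (\<lambda>n. (1 - z / complex_of_real (zeros' t s n)) * exp (z / of_real (zeros' t s n))) has_prod g z"
      "\<And>R. R > 0 \<Longrightarrow> uniform_limit (cball 0 R) (\<lambda>N z. \<Prod>n<N. (1 - z / of_real (zeros' t s n)) * exp (z / of_real (zeros' t s n))) g sequentially"
      using canonical_product[OF zeros'_nonzero[OF t s(1)] summable_zeros'[OF s]] that by blast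
    have z: "z \<in> cball 0 (norm z + 1)" by simp
    have pos: "norm z + 1 > 0" by (simp add: add_nonneg_pos)
    define u where "u = complex_of_real (sqrt t)"
    have u2: "u * u = of_real t" using t by (simp add: u_def flip: of_real_mult)
    have q: "z / of_real (1 / sqrt t) = z * u" "z / of_real (- 1 / sqrt t) = - (z * u)"
      by (simp_all add: u_def)
    have 2: "(1 - z * u) * (1 + z * u) = 1 - of_real t * z\<^sup>2"
      by (simp add: algebra_simps power2_eq_square flip: u2)
    have 1: "exp (z * u) * exp (- (z * u)) = 1" by (simp flip: exp_add)
    have "(\<Prod>n<Suc (Suc N). (1 - z / of_real (zeros' t s n)) * exp (z / of_real (zeros' t s n))) =
       ((1 - z * u) * (1 + z * u)) * (exp (z * u) * exp (- (z * u))) *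
       (\<Prod>n<N. (1 - z / of_real (zeros s n)) * exp (z / of_real (zeros s n)))" for N
    proof -
      have "zeros' t s 0 = 1 / sqrt t" "zeros' t s (Suc 0) = - 1 / sqrt t" "zeros' t s (Suc (Suc n)) = zeros s n" for n
        by (simp_all add: zeros'_def)
      thus ?thesis
        unfolding prod.lessThan_Suc_shift[of _ "Suc N"] prod.lessThan_Suc_shift[of _ "N"]
        by (simp only: q) (simp add: mult_ac)
    qed
    hence eq: "(\<Prod>n<Suc (Suc N). (1 - z / of_real (zeros' t s n)) * exp (z / of_real (zeros' t s n))) =
       (1 - of_real t * z\<^sup>2) * (\<Prod>n<N. (1 - z / of_real (zeros s n)) * exp (z / of_real (zeros s n)))" for N
      unfolding 1 2 by simp
    have "(\<lambda>N. \<Prod>n<Suc (Suc N). (1 - z / of_real (zeros' t s n)) * exp (z / of_real (zeros' t s n))) \<longlonglongrightarrow> (1 - of_real t * z\<^sup>2) * f z"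
      unfolding eq by (intro tendsto_intros tendsto_uniform_limitI[OF f(2)[OF pos] z])
    moreover have "(\<lambda>N. \<Prod>n<Suc (Suc N). (1 - z / of_real (zeros' t s n)) * exp (z / of_real (zeros' t s n))) \<longlonglongrightarrow> g z"
      by (intro LIMSEQ_Suc tendsto_uniform_limitI[OF g(2)[OF pos] z])
    ultimately have gz: "g z = (1 - of_real t * z\<^sup>2) * f z" by (rule LIMSEQ_unique[rotated])
    show ?thesis using g(1)[of z] unfolding gz .
  qed
  show ?thesis using that[OF f(1) ul hp] .
qed

section \<open>Taylor coefficients of the limit function and of its Gaussian multiples\<close>

lemma partial_product_holomorphic: "partial_product s N holomorphic_on A"
  unfolding partial_product_def[abs_def] by (intro holomorphic_intros) auto

text \<open>Uniform convergence near 0 carries over to the Taylor coefficients, and the real numbers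
  are closed. So the even coefficients are limits of those of real-rooted polynomials.\<close>

lemma base_coeffs:
  assumes "uniform_limit (cball 0 1) (partial_product s) f sequentially"
  obtains E :: "real fps" where "E $ 0 = 1"
    "\<And>k. (\<lambda>N. coeff (even_part N * symmetric_part s {..<N}) k) \<longlonglongrightarrow> E $ k"
    "\<And>k. fps_expansion f 0 $ (2 * k) = of_real (E $ k)"
    "\<And>k. fps_expansion f 0 $ k \<in> \<real>"
proof -
  let ?W = "\<lambda>N. weave (fps_of_poly (cpoly (even_part N * symmetric_part s {..<N}))) (fps_of_poly (cpoly (odd_part N * symmetric_part s {..<N})))"
  have ul: "uniform_limit (ball 0 1) (partial_product s) f sequentially"
    by (rule uniform_limit_on_subset[OF assms]) auto
  have W: "?W N $ n = (deriv ^^ n) (partial_product s N) 0 / fact n" for n N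
    by (rule fps_nth_fps_expansion[OF partial_product_expansion])
  have lim: "(\<lambda>N. ?W N $ n) \<longlonglongrightarrow> fps_expansion f 0 $ n" for n
    unfolding W fps_expansion_def fps_nth_Abs_fps
    by (intro tendsto_divide tendsto_const higher_deriv_complex_uniform_limit[OF ul])
       (auto intro!: always_eventually partial_product_holomorphic)
  have W_even: "?W N $ (2 * k) = of_real (coeff (even_part N * symmetric_part s {..<N}) k)" for N k
    by (simp only: weave_nth_even fps_of_poly_nth) (simp add: coeff_map_poly)
  have "?W N $ n \<in> \<real>" for N n
    by (simp add: weave_def fps_nth_compose_X_power coeff_map_poly)
  hence real: "fps_expansion f 0 $ n \<in> \<real>" for n
    by (intro closed_sequentially[OF closed_complex_Reals _ lim]) auto
  define E where "E = Abs_fps (\<lambda>k. Re (fps_expansion f 0 $ (2 * k)))"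
  have E: "fps_expansion f 0 $ (2 * k) = of_real (E $ k)" for k
    using real[of "2 * k"] by (simp add: E_def)
  have limE: "(\<lambda>N. coeff (even_part N * symmetric_part s {..<N}) k) \<longlonglongrightarrow> E $ k" for k
    using lim[of "2 * k"] unfolding W_even E by (simp add: tendsto_of_real_iff)
  have "coeff (even_part N * symmetric_part s {..<N}) 0 = 1" for N
    by (simp add: poly_0_coeff_0[symmetric] even_part_def parity_parts_0 symmetric_part_def poly_prod)
  with limE[of 0] have "E $ 0 = 1" by (simp add: LIMSEQ_const_iff)
  from that[OF this limE E real] show ?thesis .
qed

lemma exp_square_expansion:
  fixes c :: complex
  shows "(\<lambda>z. exp (c * z\<^sup>2)) has_fps_expansion (fps_exp c oo fps_X ^ 2)"
proof -
  have "(\<lambda>z::complex. z ^ 2) has_fps_expansion fps_X ^ 2"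
    by (rule has_fps_expansion_fps_X_power)
  from has_fps_expansion_compose[OF has_fps_expansion_exp[of c] this] show ?thesis
    by (simp add: o_def)
qed

definition complex_fps :: "real fps \<Rightarrow> complex fps" where
  "complex_fps A = Abs_fps (\<lambda>n. of_real (A $ n))"

lemma complex_fps_mult: "complex_fps (A * B) = complex_fps A * complex_fps B"
  by (rule fps_ext) (simp add: complex_fps_def fps_mult_nth)

text \<open>The factor \<open>exp (a z^2) (1 - t z^2)\<close> is a series in \<open>z^2\<close>,
  hence multiplies the even and the odd part separately.\<close>

lemma taylor_coeff_gaussian_mult:
  fixes a t :: real and E :: "real fps"
  assumes holo: "f holomorphic_on UNIV"
  assumes E: "\<And>k. fps_expansion f 0 $ (2 * k) = of_real (E $ k)" and real: "\<And>k. fps_expansion f 0 $ k \<in> \<real>"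
  defines "\<phi> \<equiv> (\<lambda>z. exp (of_real a * z\<^sup>2) * ((1 - of_real t * z\<^sup>2) * f z))"
  shows "taylor_coeff \<phi> (2 * k) = of_real ((fps_exp a * ((1 - fps_const t * fps_X) * E)) $ k)"
    and "taylor_coeff \<phi> k \<in> \<real>"
proof -
  define F where "F = fps_expansion f 0"
  define D where "D = Abs_fps (\<lambda>k. Re (F $ (2 * k + 1)))"
  have "Abs_fps (\<lambda>k. F $ (2 * k)) = complex_fps E" by (simp add: F_def E complex_fps_def)
  moreover have "F $ n = of_real (Re (F $ n))" for n using real by (simp add: F_def)
  hence "Abs_fps (\<lambda>k. F $ (2 * k + 1)) = complex_fps D" unfolding complex_fps_def D_def by simp
  ultimately have F: "F = weave (complex_fps E) (complex_fps D)"
    using weave_decomp[of F] by simp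
  have c: "fps_const c oo fps_X ^ 2 = fps_const c" and X: "fps_X oo fps_X ^ 2 = (fps_X ^ 2 :: complex fps)" for c :: complex
    by (simp_all add: fps_X_fps_compose_startby0)
  have t: "complex_fps (1 - fps_const t * fps_X) = 1 - fps_const (of_real t) * fps_X"
    by (rule fps_ext) (simp add: complex_fps_def)
  have exp: "complex_fps (fps_exp a) = fps_exp (of_real a)"
    by (rule fps_ext) (simp add: complex_fps_def)
  have "f has_fps_expansion F" unfolding F_def
    using holo by (intro has_fps_expansion_fps_expansion[of UNIV]) auto
  moreover have "(\<lambda>z::complex. 1 - of_real t * z\<^sup>2) has_fps_expansion 1 - fps_const (of_real t) * fps_X ^ 2"
    by (intro fps_expansion_intros)
  ultimately have "\<phi> has_fps_expansion (fps_exp (of_real a) oo fps_X ^ 2) * ((1 - fps_const (of_real t) * fps_X ^ 2) * F)"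
    unfolding \<phi>_def by (intro has_fps_expansion_mult exp_square_expansion)
  also have "1 - fps_const (of_real t) * fps_X ^ 2 = (1 - fps_const (complex_of_real t) * fps_X) oo fps_X ^ 2"
    unfolding fps_compose_sub_distrib compose_square_mult c X by simp
  also have "(fps_exp (of_real a) oo fps_X ^ 2) * (((1 - fps_const (of_real t) * fps_X) oo fps_X ^ 2) * F) =
     weave (complex_fps (fps_exp a * ((1 - fps_const t * fps_X) * E))) (complex_fps (fps_exp a * ((1 - fps_const t * fps_X) * D)))"
    unfolding F weave_mult_even complex_fps_mult t exp by simp
  finally have *: "taylor_coeff \<phi> n = weave (complex_fps (fps_exp a * ((1 - fps_const t * fps_X) * E)))
      (complex_fps (fps_exp a * ((1 - fps_const t * fps_X) * D))) $ n" for n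
    by (subst fps_nth_fps_expansion) (auto simp: taylor_coeff_def)
  show "taylor_coeff \<phi> (2 * k) = of_real ((fps_exp a * ((1 - fps_const t * fps_X) * E)) $ k)"
    unfolding * weave_nth_even by (simp add: complex_fps_def)
  show "taylor_coeff \<phi> k \<in> \<real>"
    unfolding * by (simp add: weave_def fps_nth_compose_X_power complex_fps_def)
qed

section \<open>Sign of a power series on the imaginary axis\<close>

lemma i_power_double: "\<i> ^ (2 * k) = (-1) ^ k"
  by (simp add: power_mult)

lemma Re_i_power_odd: "odd n \<Longrightarrow> Re (\<i> ^ n) = 0"
proof (elim oddE)
  fix k assume "n = 2 * k + 1"
  hence "\<i> ^ n = of_real ((-1) ^ k) * \<i>" by (simp add: i_power_double)
  moreover have "Re (of_real ((-1) ^ k) * \<i>) = 0" by (simp del: of_real_power)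
  ultimately show "Re (\<i> ^ n) = 0" by simp
qed

text \<open>The odd terms vanish. For \<open>y \<ge> 0\<close> all terms beyond index
  \<open>2 * K\<close> are nonnegative, so \<open>R y\<close> is at least a polynomial of degree
  \<open>2 * K\<close> with positive leading coefficient.\<close>

lemma eventually_positive_on_imaginary_axis:
  fixes c :: "nat \<Rightarrow> real"
  assumes sums: "\<And>y. (\<lambda>n. c n * Re (\<i> ^ n) * y ^ n) sums R y"
  assumes pos: "\<And>k. k \<ge> K \<Longrightarrow> (-1) ^ k * c (2 * k) > 0"
  shows "\<exists>Y. \<forall>y\<ge>Y. R y > 0"
proof -
  define P where "P = (\<Sum>n<Suc (2 * K). monom (c n * Re (\<i> ^ n)) n)"
  have Pc: "coeff P n = (if n < Suc (2 * K) then c n * Re (\<i> ^ n) else 0)" for n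
    by (simp add: P_def coeff_sum del: sum.lessThan_Suc)
  have Re: "Re (\<i> ^ (2 * k)) = (-1) ^ k" for k
    unfolding i_power_double by (induction k) simp_all
  have "coeff P (2 * K) = c (2 * K) * (-1) ^ K" unfolding Pc Re by simp
  hence "coeff P (2 * K) > 0" using pos[of K] by (simp add: mult.commute)
  moreover have "degree P = 2 * K"
  proof (rule antisym)
    show "degree P \<le> 2 * K" by (rule degree_le) (simp add: Pc)
    show "2 * K \<le> degree P" by (rule le_degree) (use \<open>coeff P (2 * K) > 0\<close> in linarith)
  qed
  ultimately obtain Y where Y: "\<And>y. y \<ge> Y \<Longrightarrow> poly P y > 0"
    using poly_pinfty_gt_lc[of P] by (metis less_le_trans)
  have "R y > 0" if y: "y \<ge> max 0 Y" for y
  proof -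
    have "poly P y = (\<Sum>n<Suc (2 * K). c n * Re (\<i> ^ n) * y ^ n)"
      by (simp add: P_def poly_sum poly_monom)
    also have "\<dots> \<le> (\<Sum>n. c n * Re (\<i> ^ n) * y ^ n)"
    proof (rule sum_le_suminf)
      fix n assume n: "n \<in> - {..<Suc (2 * K)}"
      show "0 \<le> c n * Re (\<i> ^ n) * y ^ n"
      proof (cases "even n")
        case True
        then obtain k where k: "n = 2 * k" by blast
        have "0 < (-1) ^ k * c (2 * k)" using n k by (intro pos) auto
        thus ?thesis using y unfolding k Re by (simp add: mult.commute)
      qed (simp add: Re_i_power_odd)
    qed (use sums in \<open>auto simp: sums_iff\<close>)
    also have "\<dots> = R y" using sums by (simp add: sums_iff)
    finally show ?thesis using Y[of y] y by simp
  qed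
  thus ?thesis by blast
qed

section \<open>The argument on the imaginary axis\<close>

lemma abs_arctan_le_abs: "\<bar>arctan x\<bar> \<le> \<bar>x\<bar>"
proof (cases "x = 0")
  case False
  define y where "y = \<bar>x\<bar>"
  have y: "y > 0" using False by (simp add: y_def)
  have "\<exists>z>0. z < y \<and> arctan y - arctan 0 = (y - 0) * inverse (1 + z\<^sup>2)"
    using y by (intro MVT2) (auto intro!: DERIV_arctan)
  then obtain z where z: "arctan y = y * inverse (1 + z\<^sup>2)" by auto
  also have "\<dots> \<le> y * 1" using y by (intro mult_left_mono) (auto simp: inverse_le_1_iff add_pos_nonneg)
  finally have "arctan y \<le> y" by simp
  thus ?thesis unfolding y_def by (cases "x \<ge> 0") (auto simp: arctan_minus)
qed simp

lemma one_plus_i_polar: "1 + \<i> * of_real x = of_real (norm (1 + \<i> * of_real x)) * cis (arctan x)"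
proof -
  have "norm (1 + \<i> * of_real x) = sqrt (1 + x\<^sup>2)" by (simp add: cmod_def)
  moreover have "sqrt (1 + x\<^sup>2) \<noteq> 0" by (simp add: add_nonneg_eq_0_iff)
  ultimately show ?thesis by (simp add: complex_eq_iff cos_arctan sin_arctan)
qed

text \<open>A continuous branch of the argument of \<open>f (i y)\<close>: the factor
  \<open>1 + 2 z\<close> contributes the first term, \<open>1 - z / 2^n\<close> the summands, and
  the factors of the pairs are positive there.\<close>

definition theta :: "real \<Rightarrow> real" where
  "theta y = arctan (2 * y) - (\<Sum>n. arctan (y / 2 ^ n))"

lemma summable_arctan: "summable (\<lambda>n. arctan (y / 2 ^ n))"
proof (rule summable_comparison_test')
  have "summable (\<lambda>n. \<bar>y\<bar> * (1 / 2) ^ n)" by (intro summable_mult summable_geometric) simp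
  thus "summable (\<lambda>n. \<bar>y\<bar> / 2 ^ n)" by (simp add: power_divide)
  show "norm (arctan (y / 2 ^ n)) \<le> \<bar>y\<bar> / 2 ^ n" for n
    using abs_arctan_le_abs[of "y / 2 ^ n"] by simp
qed

lemma continuous_on_theta: "continuous_on {a..b} theta"
proof -
  define R where "R = max \<bar>a\<bar> \<bar>b\<bar>"
  have "uniform_limit {a..b} (\<lambda>N y. \<Sum>n<N. arctan (y / 2 ^ n)) (\<lambda>y. \<Sum>n. arctan (y / 2 ^ n)) sequentially"
  proof (rule Weierstrass_m_test)
    have "summable (\<lambda>n. R * (1 / 2) ^ n)" by (intro summable_mult summable_geometric) simp
    thus "summable (\<lambda>n. R / 2 ^ n)" by (simp add: power_divide)
    fix n y assume "y \<in> {a..b}"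
    hence "\<bar>y\<bar> \<le> R" by (auto simp: R_def)
    hence "\<bar>y / 2 ^ n\<bar> \<le> R / 2 ^ n" by (simp add: divide_right_mono)
    thus "norm (arctan (y / 2 ^ n)) \<le> R / 2 ^ n"
      using abs_arctan_le_abs[of "y / 2 ^ n"] by simp
  qed
  hence "continuous_on {a..b} (\<lambda>y. \<Sum>n. arctan (y / 2 ^ n))"
    by (rule uniform_limit_theorem[rotated]) (auto intro!: always_eventually continuous_intros)
  thus ?thesis unfolding theta_def[abs_def] by (intro continuous_intros)
qed

text \<open>Each zero \<open>2^n\<close> with \<open>n < N\<close> is at most \<open>y\<close> and
  turns the argument by at least \<open>pi / 4\<close>.\<close>

lemma theta_le:
  assumes "y \<ge> 2 ^ N"
  shows   "theta y \<le> pi / 2 - real N * (pi / 4)"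
proof -
  have "y \<ge> 0" using assms zero_le_power[of "2::real" N] by linarith
  have "real N * (pi / 4) = (\<Sum>n<N. pi / 4)" by simp
  also have "\<dots> \<le> (\<Sum>n<N. arctan (y / 2 ^ n))"
  proof (rule sum_mono)
    fix n assume "n \<in> {..<N}"
    hence "(2::real) ^ n \<le> 2 ^ N" by (intro power_increasing) auto
    hence "(2::real) ^ n \<le> y" using assms by (rule order_trans)
    hence "1 \<le> y / 2 ^ n" by (simp add: field_simps)
    thus "pi / 4 \<le> arctan (y / 2 ^ n)"
      using arctan_le_iff[of 1 "y / 2 ^ n"] by (simp add: arctan_one)
  qed
  also have "\<dots> \<le> (\<Sum>n. arctan (y / 2 ^ n))"
    using \<open>y \<ge> 0\<close> by (intro sum_le_suminf summable_arctan) auto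
  finally show ?thesis using arctan_ubound[of "2 * y"] unfolding theta_def by linarith
qed

lemma theta_attains:
  assumes "- real j * pi \<le> theta Y"
  obtains y where "y \<ge> Y" "theta y = - real j * pi"
proof -
  \<comment> \<open>With \<open>N = 4 * j + 2\<close> the bound of \<open>theta_le\<close> is
    exactly \<open>- j * pi\<close>.\<close>
  define Z where "Z = max Y (2 ^ (4 * j + 2))"
  have "theta Z \<le> pi / 2 - real (4 * j + 2) * (pi / 4)"
    by (rule theta_le) (simp add: Z_def)
  also have "\<dots> = - real j * pi" by (simp add: field_simps)
  finally have "theta Z \<le> - real j * pi" .
  moreover have "Y \<le> Z" by (simp add: Z_def)
  ultimately show ?thesis
    using IVT2'[of theta Z "- real j * pi" Y] assms continuous_on_theta that by blast
qed

context
  fixes s :: "nat \<Rightarrow> real" and f :: "complex \<Rightarrow> complex"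
  assumes s: "\<And>n. s n > 0"
  assumes ul: "\<And>R. R > 0 \<Longrightarrow> uniform_limit (cball 0 R) (partial_product s) f sequentially"
begin

lemma partial_product_tendsto: "(\<lambda>N. partial_product s N z) \<longlonglongrightarrow> f z"
proof -
  have "norm z + 1 > 0" by (simp add: add_nonneg_pos)
  from tendsto_uniform_limitI[OF ul[OF this], of z] show ?thesis by simp
qed

lemma partial_product_i:
  "partial_product s N (\<i> * of_real y) = (1 + \<i> * of_real (2 * y)) * (\<Prod>n<N. (1 + \<i> * of_real (- y / 2 ^ n)) * of_real (1 + s n * y\<^sup>2))"
  by (simp add: partial_product_def power_mult_distrib algebra_simps)

lemma partial_product_polar:
  "partial_product s N (\<i> * of_real y) = of_real (norm (partial_product s N (\<i> * of_real y))) * cis (arctan (2 * y) - (\<Sum>n<N. arctan (y / 2 ^ n)))"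
proof (induction N)
  case 0
  show ?case using one_plus_i_polar[of "2 * y"] by (simp add: partial_product_i)
next
  case (Suc N)
  define v where "v = 1 + \<i> * of_real (- y / 2 ^ N)"
  define r where "r = 1 + s N * y\<^sup>2"
  have r: "r > 0" using s[of N] by (simp add: r_def add_pos_nonneg)
  have v: "v = of_real (norm v) * cis (- arctan (y / 2 ^ N))"
    using one_plus_i_polar[of "- y / 2 ^ N"] by (simp add: v_def arctan_minus)
  have step: "partial_product s (Suc N) (\<i> * of_real y) = partial_product s N (\<i> * of_real y) * v * of_real r"
    by (simp add: partial_product_i v_def r_def mult_ac)
  have "norm (partial_product s (Suc N) (\<i> * of_real y)) = norm (partial_product s N (\<i> * of_real y)) * norm v * r"
    unfolding step norm_mult using r by simp
  moreover have "cis (arctan (2 * y) - (\<Sum>n<Suc N. arctan (y / 2 ^ n))) =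
      cis (arctan (2 * y) - (\<Sum>n<N. arctan (y / 2 ^ n))) * cis (- arctan (y / 2 ^ N))"
    by (simp add: cis_mult algebra_simps)
  ultimately have "of_real (norm (partial_product s (Suc N) (\<i> * of_real y))) * cis (arctan (2 * y) - (\<Sum>n<Suc N. arctan (y / 2 ^ n))) =
     (of_real (norm (partial_product s N (\<i> * of_real y))) * cis (arctan (2 * y) - (\<Sum>n<N. arctan (y / 2 ^ n)))) *
     (of_real (norm v) * cis (- arctan (y / 2 ^ N))) * of_real r"
    by (simp only: of_real_mult mult_ac)
  also have "\<dots> = partial_product s (Suc N) (\<i> * of_real y)"
    unfolding step by (simp only: Suc[symmetric] v[symmetric])
  finally show ?case ..
qed

text \<open>Limit of the polar forms of the partial products; their angles are explicit sums, so no
  branch of the argument has to be followed.\<close>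

lemma polar_imaginary_axis: "f (\<i> * of_real y) = of_real (norm (f (\<i> * of_real y))) * cis (theta y)"
proof -
  have "(\<lambda>N. arctan (2 * y) - (\<Sum>n<N. arctan (y / 2 ^ n))) \<longlonglongrightarrow> theta y"
    unfolding theta_def by (intro tendsto_intros summable_LIMSEQ summable_arctan)
  hence "(\<lambda>N. cis (arctan (2 * y) - (\<Sum>n<N. arctan (y / 2 ^ n)))) \<longlonglongrightarrow> cis (theta y)"
    unfolding cis_conv_exp by (intro tendsto_intros)
  hence "(\<lambda>N. of_real (norm (partial_product s N (\<i> * of_real y))) * cis (arctan (2 * y) - (\<Sum>n<N. arctan (y / 2 ^ n))))
     \<longlonglongrightarrow> of_real (norm (f (\<i> * of_real y))) * cis (theta y)"
    by (intro tendsto_mult tendsto_of_real tendsto_norm partial_product_tendsto)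
  hence "(\<lambda>N. partial_product s N (\<i> * of_real y)) \<longlonglongrightarrow> of_real (norm (f (\<i> * of_real y))) * cis (theta y)"
    by (subst partial_product_polar)
  with partial_product_tendsto show ?thesis by (rule LIMSEQ_unique)
qed

text \<open>For the lower bound of the order: on the imaginary axis every factor has modulus at
  least 1, so all but the first \<open>M\<close> pairs may be dropped.\<close>

lemma norm_imaginary_axis_ge: "norm (f (\<i> * of_real y)) \<ge> (\<Prod>n<M. 1 + s n * y\<^sup>2)"
proof (rule tendsto_lowerbound[OF tendsto_norm[OF partial_product_tendsto]])
  have ge1: "norm (1 + \<i> * of_real x) \<ge> 1" for x
    using complex_Re_le_cmod[of "1 + \<i> * of_real x"] by simp
  have pos: "1 + s n * y\<^sup>2 \<ge> 1" for n using s[of n] by simp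
  show "\<forall>\<^sub>F N in sequentially. (\<Prod>n<M. 1 + s n * y\<^sup>2) \<le> norm (partial_product s N (\<i> * of_real y))"
    using eventually_ge_at_top[of M]
  proof eventually_elim
    case (elim N)
    have "(\<Prod>n<M. 1 + s n * y\<^sup>2) \<le> (\<Prod>n<N. 1 + s n * y\<^sup>2)"
      using elim s by (intro prod_mono2) (auto simp: add_nonneg_nonneg less_imp_le)
    also have "\<dots> \<le> (\<Prod>n<N. norm ((1 + \<i> * of_real (- y / 2 ^ n)) * of_real (1 + s n * y\<^sup>2)))"
    proof (rule prod_mono, rule conjI)
      fix n
      have "1 * (1 + s n * y\<^sup>2) \<le> norm (1 + \<i> * of_real (- y / 2 ^ n)) * norm (complex_of_real (1 + s n * y\<^sup>2))"
        by (intro mult_mono ge1) (use pos[of n] in \<open>simp_all del: of_real_add\<close>)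
      thus "1 + s n * y\<^sup>2 \<le> norm ((1 + \<i> * of_real (- y / 2 ^ n)) * of_real (1 + s n * y\<^sup>2))"
        by (simp only: norm_mult mult_1)
      show "0 \<le> 1 + s n * y\<^sup>2" using pos[of n] by linarith
    qed
    also have "\<dots> = 1 * \<dots>" by simp
    also have "\<dots> \<le> norm (1 + \<i> * of_real (2 * y)) *
        (\<Prod>n<N. norm ((1 + \<i> * of_real (- y / 2 ^ n)) * of_real (1 + s n * y\<^sup>2)))"
      by (intro mult_right_mono ge1 prod_nonneg norm_ge_zero ballI)
    also have "\<dots> = norm (partial_product s N (\<i> * of_real y))"
      by (subst partial_product_i, subst norm_mult, subst prod_norm) (rule refl)
    finally show ?case .
  qed
qed auto

lemma sign_repetition:
  fixes A :: "nat \<Rightarrow> real" and t a :: real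
  assumes t: "t > 0" and holo: "f holomorphic_on UNIV"
  defines "\<phi> \<equiv> (\<lambda>z. exp (of_real a * z\<^sup>2) * ((1 - of_real t * z\<^sup>2) * f z))"
  assumes coeff: "\<And>k. taylor_coeff \<phi> (2 * k) = of_real (A k)" and real: "\<And>k. taylor_coeff \<phi> k \<in> \<real>"
  assumes one_zero: "\<And>k l. A k = 0 \<Longrightarrow> A l = 0 \<Longrightarrow> k = l"
  shows "\<exists>k>n0. A k * A (Suc k) > 0"
proof (rule ccontr)
  assume "\<not> (\<exists>k>n0. A k * A (Suc k) > 0)"
  hence le: "A k * A (Suc k) \<le> 0" if "k > n0" for k using that by (meson not_le)
  \<comment> \<open>At most one \<open>A k\<close> vanishes, so the products are strictly negative
    from \<open>K\<close> on.\<close>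
  obtain K where K: "K > n0" "\<And>k. k \<ge> K \<Longrightarrow> A k \<noteq> 0"
  proof (cases "\<exists>k. A k = 0")
    case True
    then obtain k where "A k = 0" by auto
    hence "A l \<noteq> 0" if "l \<ge> max n0 k + 1" for l
      using one_zero[of k l] that by auto
    thus ?thesis using that[of "max n0 k + 1"] by auto
  next
    case False
    thus ?thesis using that[of "n0 + 1"] by auto
  qed
  \<comment> \<open>With the alternating sign removed, neighbours from \<open>K\<close> on have
    equal sign, which \<open>\<sigma>\<close> records.\<close>
  define b where "b = (\<lambda>k. (-1) ^ k * A k)"
  have b: "b k * b (Suc k) > 0" if "k \<ge> K" for k
  proof -
    have "((-1) ^ k * (-1) ^ k :: real) = 1" by (simp flip: power_mult_distrib)
    hence "b k * b (Suc k) = - (A k * A (Suc k))"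
      unfolding b_def by (simp add: algebra_simps flip: mult.assoc)
    moreover have "A k * A (Suc k) \<noteq> 0" using K that by simp
    moreover have "A k * A (Suc k) \<le> 0" using le K that by simp
    ultimately show ?thesis by linarith
  qed
  define \<sigma> where "\<sigma> = sgn (b K)"
  have \<sigma>b: "\<sigma> * b k > 0" if "k \<ge> K" for k
    using that
  proof (induction k rule: dec_induct)
    case base
    have "b K \<noteq> 0" using K by (simp add: b_def)
    thus ?case by (simp add: \<sigma>_def abs_sgn[symmetric] mult.commute)
  next
    case (step k)
    have "(\<sigma> * b k) * (b k * b (Suc k)) > 0" by (rule mult_pos_pos[OF step.IH b[OF step.hyps(1)]])
    hence "(b k)\<^sup>2 * (\<sigma> * b (Suc k)) > 0" by (simp add: power2_eq_square mult_ac)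
    thus ?case by (simp add: zero_less_mult_iff)
  qed
  define c where "c = (\<lambda>n. \<sigma> * Re (taylor_coeff \<phi> n))"
  have \<phi>_holo: "\<phi> holomorphic_on ball 0 r" for r
    unfolding \<phi>_def by (intro holomorphic_intros holomorphic_on_subset[OF holo]) auto
  have "(\<lambda>n. c n * Re (\<i> ^ n) * y ^ n) sums (\<sigma> * Re (\<phi> (\<i> * of_real y)))" for y
  proof -
    have "\<i> * of_real y \<in> ball 0 (\<bar>y\<bar> + 1)" by (simp add: norm_mult)
    from holomorphic_power_series[OF \<phi>_holo this]
    have "(\<lambda>n. taylor_coeff \<phi> n * (\<i> * of_real y) ^ n) sums \<phi> (\<i> * of_real y)"
      by (simp add: taylor_coeff_def)
    hence "(\<lambda>n. \<sigma> * Re (taylor_coeff \<phi> n * (\<i> * of_real y) ^ n)) sums (\<sigma> * Re (\<phi> (\<i> * of_real y)))"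
      by (intro sums_mult sums_Re)
    moreover have "Re (taylor_coeff \<phi> n * (\<i> * of_real y) ^ n) = Re (taylor_coeff \<phi> n) * Re (\<i> ^ n) * y ^ n" for n
    proof -
      obtain r where r: "taylor_coeff \<phi> n = of_real r" using real[of n] by (auto elim: Reals_cases)
      have "taylor_coeff \<phi> n * (\<i> * of_real y) ^ n = of_real (r * y ^ n) * \<i> ^ n"
        by (simp add: r power_mult_distrib)
      thus ?thesis by (simp only: r) simp
    qed
    ultimately show ?thesis by (simp add: c_def mult_ac)
  qed
  moreover have "(-1) ^ k * c (2 * k) > 0" if "k \<ge> K" for k
  proof -
    have "c (2 * k) = \<sigma> * A k" by (simp add: c_def coeff)
    thus ?thesis using \<sigma>b[OF that] by (simp add: b_def mult_ac)
  qed
  ultimately obtain Y where Y: "\<And>y. y \<ge> Y \<Longrightarrow> \<sigma> * Re (\<phi> (\<i> * of_real y)) > 0"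
    using eventually_positive_on_imaginary_axis[of c "\<lambda>y. \<sigma> * Re (\<phi> (\<i> * of_real y))" K] by blast
  obtain m :: nat where m: "real m \<ge> - theta Y / pi" using real_arch_simple by blast
  \<comment> \<open>The parity makes \<open>(-1)^j\<close> opposite to \<open>\<sigma>\<close>,
    while \<open>j \<ge> m\<close> keeps \<open>- j * pi\<close> at or below \<open>theta Y\<close>.
    Where \<open>theta\<close> takes that value, \<open>f (i y)\<close> is a nonnegative multiple of
    \<open>(-1)^j\<close>.\<close>
  define j where "j = 2 * m + (if \<sigma> > 0 then 1 else 0)"
  have "real j \<ge> - theta Y / pi" using m by (simp add: j_def) 
  hence "- real j * pi \<le> theta Y" by (simp add: field_simps)
  then obtain y where y: "y \<ge> Y" "theta y = - real j * pi" by (rule theta_attains)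
  have "cis (theta y) = (-1) ^ j"
    unfolding y by (simp add: complex_eq_iff cos_npi2 sin_npi2)
  define F where "F = norm (f (\<i> * of_real y))"
  have sq: "(\<i> * of_real y)\<^sup>2 = - of_real (y\<^sup>2)" by (simp add: power_mult_distrib)
  have "f (\<i> * of_real y) = of_real (F * (-1) ^ j)"
    using polar_imaginary_axis[of y] \<open>cis (theta y) = (-1) ^ j\<close> by (simp add: F_def)
  hence "\<phi> (\<i> * of_real y) = of_real (exp (- a * y\<^sup>2) * ((1 + t * y\<^sup>2) * (F * (-1) ^ j)))"
    unfolding \<phi>_def sq by (simp add: exp_of_real[symmetric] del: exp_of_real)
  hence "\<sigma> * Re (\<phi> (\<i> * of_real y)) = (exp (- a * y\<^sup>2) * (1 + t * y\<^sup>2) * F) * (\<sigma> * (-1) ^ j)"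
    by (simp add: mult_ac)
  moreover have "\<sigma> * (-1) ^ j \<le> 0"
    by (simp add: j_def power_mult)
  moreover have "exp (- a * y\<^sup>2) * (1 + t * y\<^sup>2) * F \<ge> 0"
    using t by (simp add: F_def)
  ultimately have "\<sigma> * Re (\<phi> (\<i> * of_real y)) \<le> 0" by (metis mult_nonneg_nonpos)
  with Y[OF y(1)] show False by simp
qed

end

section \<open>The order\<close>

lemma norm_le_max_modulus:
  assumes "f holomorphic_on UNIV" "norm z = r"
  shows   "norm (f z) \<le> max_modulus f r"
proof -
  have "continuous_on (sphere 0 r) f"
    using assms(1) by (metis holomorphic_on_imp_continuous_on continuous_on_subset subset_UNIV)
  hence "compact ((\<lambda>z. norm (f z)) ` sphere 0 r)"
    by (intro compact_continuous_image continuous_intros) auto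
  hence "bdd_above ((\<lambda>z. norm (f z)) ` sphere 0 r)"
    by (intro bounded_imp_bdd_above compact_imp_bounded)
  thus ?thesis unfolding max_modulus_def using assms(2) by (intro cSup_upper) auto
qed

lemma max_modulus_le:
  assumes "r \<ge> 0" "\<And>z. norm z = r \<Longrightarrow> norm (f z) \<le> B"
  shows   "max_modulus f r \<le> B"
  unfolding max_modulus_def
proof (rule cSup_least)
  have "of_real r \<in> sphere (0 :: complex) r" using assms(1) by simp
  thus "(\<lambda>z. norm (f z)) ` sphere 0 r \<noteq> {}" by blast
qed (use assms in auto)

text \<open>The order is a limsup, so the lower estimate is required only frequently. Positivity of
  \<open>ln (max_modulus f r)\<close> lets the upper estimate pass through the outer
  logarithm.\<close>

lemma entire_order_eqI:
  assumes pos: "eventually (\<lambda>r. ln (max_modulus f r) > 0) at_top"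
  assumes upper: "\<And>\<sigma>. \<sigma> > \<rho> \<Longrightarrow> eventually (\<lambda>r. ln (max_modulus f r) \<le> r powr \<sigma>) at_top"
  assumes lower: "\<And>\<tau>. \<tau> < \<rho> \<Longrightarrow> frequently (\<lambda>r. r powr \<tau> \<le> ln (max_modulus f r)) at_top"
  shows "entire_order f = ereal \<rho>"
proof (rule antisym)
  let ?X = "\<lambda>r. ln (ln (max_modulus f r)) / ln r"
  show "entire_order f \<le> ereal \<rho>"
  proof (rule dense_ge)
    fix y assume y: "ereal \<rho> < y"
    show "entire_order f \<le> y"
    proof (cases y)
      case (real \<sigma>)
      hence "\<sigma> > \<rho>" using y by simp
      have "eventually (\<lambda>r. ?X r \<le> \<sigma>) at_top"
        using pos upper[OF \<open>\<sigma> > \<rho>\<close>] eventually_gt_at_top[of 1]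
      proof eventually_elim
        case (elim r)
        have "ln (ln (max_modulus f r)) \<le> ln (r powr \<sigma>)" using elim by (subst ln_le_cancel_iff) auto
        thus ?case using elim by (simp add: ln_powr divide_simps)
      qed
      hence "eventually (\<lambda>r. ereal (?X r) \<le> y) at_top" unfolding real by simp
      thus ?thesis unfolding entire_order_def by (rule Limsup_bounded)
    qed (use y in auto)
  qed
  show "ereal \<rho> \<le> entire_order f"
  proof (rule ccontr)
    assume "\<not> ereal \<rho> \<le> entire_order f"
    then obtain y where y: "entire_order f < y" "y < ereal \<rho>"
      using dense by (auto simp: not_le)
    then obtain \<tau> where \<tau>: "y = ereal \<tau>" by (cases y) auto
    have "eventually (\<lambda>r. ereal (?X r) < ereal \<tau>) at_top"
      using y(1) unfolding entire_order_def \<tau> by (rule Limsup_lessD)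
    hence "eventually (\<lambda>r. \<not> r powr \<tau> \<le> ln (max_modulus f r)) at_top"
      using eventually_gt_at_top[of 1]
    proof eventually_elim
      case (elim r)
      show ?case
      proof
        assume le: "r powr \<tau> \<le> ln (max_modulus f r)"
        have "ln (r powr \<tau>) \<le> ln (ln (max_modulus f r))"
          using le elim by (intro ln_mono) auto
        thus False using elim by (simp add: ln_powr divide_simps)
      qed
    qed
    moreover have "\<tau> < \<rho>" using y(2) \<tau> by simp
    ultimately show False using lower[of \<tau>] by (simp add: frequently_def)
  qed
qed

text \<open>Turns products of factors \<open>1 + x\<close> into sums of powers. For
  \<open>x \<le> 1\<close> it rests on \<open>x \<le> x powr \<kappa>\<close>, for larger
  \<open>x\<close> on \<open>ln 2 \<le> 1\<close> and
  \<open>ln x \<le> x powr \<kappa> / \<kappa>\<close>.\<close>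

lemma one_plus_le_exp_powr:
  fixes x \<kappa> :: real
  assumes "x \<ge> 0" "0 < \<kappa>" "\<kappa> \<le> 1"
  shows   "1 + x \<le> exp ((1 + 1 / \<kappa>) * x powr \<kappa>)"
proof (cases "x \<le> 1")
  case True
  have "x = x powr 1" using assms by simp
  also have "\<dots> \<le> x powr \<kappa>" using assms True by (intro powr_mono') auto
  also have "\<dots> \<le> (1 + 1 / \<kappa>) * x powr \<kappa>" using assms by (simp add: algebra_simps)
  finally have "exp x \<le> exp ((1 + 1 / \<kappa>) * x powr \<kappa>)" by simp
  thus ?thesis using exp_ge_add_one_self[of x] by linarith
next
  case False
  have "ln (1 + x) \<le> ln (2 * x)" using False by (subst ln_le_cancel_iff) auto
  also have "\<dots> = ln 2 + ln x" using False by (simp add: ln_mult)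
  also have "\<dots> \<le> 1 * x powr \<kappa> + x powr \<kappa> / \<kappa>"
  proof (intro add_mono)
    have "ln 2 \<le> (1::real)" using ln_2_less_1 by linarith
    also have "1 \<le> x powr \<kappa>" using False assms by (intro ge_one_powr_ge_zero) auto
    finally show "ln 2 \<le> 1 * x powr \<kappa>" by simp
    show "ln x \<le> x powr \<kappa> / \<kappa>" using False assms by (intro ln_powr_bound) auto
  qed
  also have "\<dots> = (1 + 1 / \<kappa>) * x powr \<kappa>" by (simp add: algebra_simps)
  finally have "exp (ln (1 + x)) \<le> exp ((1 + 1 / \<kappa>) * x powr \<kappa>)" by simp
  thus ?thesis using False by simp
qed

text \<open>The bound is uniform in \<open>N\<close> and so passes to the limit. An exponent
  \<open>\<kappa>\<close> for the pairs in \<open>z^2\<close> means \<open>2 * \<kappa>\<close> in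
  \<open>z\<close>; the other zeros only need \<open>r powr \<kappa>\<close>, which is smaller
  because \<open>r \<ge> 1\<close>.\<close>

lemma norm_partial_product_le:
  assumes s: "\<And>n. s n > 0" and \<kappa>: "0 < \<kappa>" "\<kappa> \<le> 1" "summable (\<lambda>n. s n powr \<kappa>)"
  shows "\<exists>B. \<forall>N z. norm z \<ge> 1 \<longrightarrow> norm (partial_product s N z) \<le> exp (B * norm z powr (2 * \<kappa>))"
proof (intro exI allI impI)
  fix N and z :: complex assume z: "norm z \<ge> 1"
  define r where "r = norm z"
  define C where "C = 1 + 1 / \<kappa>"
  define R where "R = r powr (2 * \<kappa>)"
  have r: "r \<ge> 1" using z by (simp add: r_def)
  have C: "C \<ge> 0" using \<kappa> by (simp add: C_def)
  have E: "1 + x \<le> exp (C * x powr \<kappa>)" if "x \<ge> 0" for x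
    unfolding C_def by (rule one_plus_le_exp_powr) (use that \<kappa> in auto)
  have rR: "r powr \<kappa> \<le> R" unfolding R_def using r \<kappa> by (intro powr_mono) auto
  have geo: "summable (\<lambda>n. ((1 / 2) powr \<kappa>) ^ n)"
    using \<kappa> powr_less_mono2[of \<kappa> "1 / 2" 1] by (intro summable_geometric) auto
  have fac: "norm ((1 - z / 2 ^ n) * (1 - of_real (s n) * z\<^sup>2)) \<le> exp (C * R * (((1 / 2) powr \<kappa>) ^ n + s n powr \<kappa>))" for n
  proof -
    have "norm (1 - z / 2 ^ n) \<le> 1 + r / 2 ^ n"
      using norm_triangle_ineq4[of 1 "z / 2 ^ n"] by (simp add: r_def norm_divide norm_power)
    also have "\<dots> \<le> exp (C * (r / 2 ^ n) powr \<kappa>)" using r by (intro E) auto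
    also have "(r / 2 ^ n) powr \<kappa> = r powr \<kappa> * ((1 / 2) powr \<kappa>) ^ n"
      using r by (simp add: powr_divide powr_powr powr_realpow[symmetric] mult.commute divide_simps)
    also have "exp (C * (r powr \<kappa> * ((1 / 2) powr \<kappa>) ^ n)) \<le> exp (C * (R * ((1 / 2) powr \<kappa>) ^ n))"
      using C rR by (simp add: mult_left_mono mult_right_mono)
    finally have 1: "norm (1 - z / 2 ^ n) \<le> exp (C * (R * ((1 / 2) powr \<kappa>) ^ n))" .
    have "norm (1 - of_real (s n) * z\<^sup>2) \<le> 1 + s n * r\<^sup>2"
      using norm_triangle_ineq4[of 1 "of_real (s n) * z\<^sup>2"] s[of n] by (simp add: r_def norm_mult norm_power)
    also have "\<dots> \<le> exp (C * (s n * r\<^sup>2) powr \<kappa>)" using s[of n] by (intro E) auto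
    also have "(s n * r\<^sup>2) powr \<kappa> = R * s n powr \<kappa>"
      using r s[of n] by (simp add: powr_mult R_def powr_powr powr_realpow[symmetric] flip: powr_numeral)
    finally have 2: "norm (1 - of_real (s n) * z\<^sup>2) \<le> exp (C * (R * s n powr \<kappa>))" .
    have "norm ((1 - z / 2 ^ n) * (1 - of_real (s n) * z\<^sup>2)) \<le>
        exp (C * (R * ((1 / 2) powr \<kappa>) ^ n)) * exp (C * (R * s n powr \<kappa>))"
      unfolding norm_mult by (intro mult_mono 1 2) auto
    thus ?thesis by (simp add: algebra_simps flip: exp_add)
  qed
  have "norm (1 + 2 * z) \<le> 1 + 2 * r"
    using norm_triangle_ineq[of 1 "2 * z"] by (simp add: r_def norm_mult)
  also have "\<dots> \<le> exp (C * (2 * r) powr \<kappa>)" using r by (intro E) auto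
  also have "\<dots> \<le> exp (C * (2 powr \<kappa> * R))"
    using C rR r by (simp add: powr_mult mult_left_mono)
  finally have 0: "norm (1 + 2 * z) \<le> exp (C * (2 powr \<kappa> * R))" .
  have "norm (partial_product s N z) = norm (1 + 2 * z) * (\<Prod>n<N. norm ((1 - z / 2 ^ n) * (1 - of_real (s n) * z\<^sup>2)))"
    unfolding partial_product_def norm_mult[of "1 + 2 * z"] prod_norm ..
  also have "\<dots> \<le> exp (C * (2 powr \<kappa> * R)) * (\<Prod>n<N. exp (C * R * (((1 / 2) powr \<kappa>) ^ n + s n powr \<kappa>)))"
    by (intro mult_mono 0 prod_mono prod_nonneg) (auto intro: fac)
  also have "\<dots> = exp (C * R * (2 powr \<kappa> + ((\<Sum>n<N. ((1 / 2) powr \<kappa>) ^ n) + (\<Sum>n<N. s n powr \<kappa>))))"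
    by (simp add: exp_sum[symmetric] sum_distrib_left[symmetric] sum.distrib algebra_simps flip: exp_add)
  also have "\<dots> \<le> exp (C * R * (2 powr \<kappa> + ((\<Sum>n. ((1 / 2) powr \<kappa>) ^ n) + (\<Sum>n. s n powr \<kappa>))))"
  proof -
    have "C * R * (2 powr \<kappa> + ((\<Sum>n<N. ((1 / 2) powr \<kappa>) ^ n) + (\<Sum>n<N. s n powr \<kappa>))) \<le>
          C * R * (2 powr \<kappa> + ((\<Sum>n. ((1 / 2) powr \<kappa>) ^ n) + (\<Sum>n. s n powr \<kappa>)))"
      using C by (intro mult_left_mono add_mono order_refl sum_le_suminf geo \<kappa>(3)) (auto simp: R_def)
    thus ?thesis by simp
  qed
  also have "\<dots> = exp ((C * (2 powr \<kappa> + ((\<Sum>n. ((1 / 2) powr \<kappa>) ^ n) + (\<Sum>n. s n powr \<kappa>)))) * norm z powr (2 * \<kappa>))"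
    by (simp add: R_def r_def mult_ac)
  finally show "norm (partial_product s N z) \<le> exp ((((1 + 1 / \<kappa>)) * (2 powr \<kappa> + ((\<Sum>n. ((1 / 2) powr \<kappa>) ^ n) + (\<Sum>n. s n powr \<kappa>)))) * norm z powr (2 * \<kappa>))"
    unfolding C_def .
qed

text \<open>At \<open>i r\<close> each pair with \<open>1 \<le> s n * r^2\<close> contributes a
  factor of at least 2, whence \<open>real M * ln 2\<close> in \<open>lower\<close>. The exponents
  from \<open>upper\<close> feed \<open>norm_partial_product_le\<close>.\<close>

lemma entire_order_base_function:
  fixes \<rho> t :: real
  assumes s: "\<And>n. s n > 0" and t: "t > 0"
  assumes ul: "\<And>R. R > 0 \<Longrightarrow> uniform_limit (cball 0 R) (partial_product s) f sequentially"
  assumes holo: "f holomorphic_on UNIV"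
  assumes upper: "\<And>\<sigma>. \<sigma> > \<rho> \<Longrightarrow> \<exists>\<kappa>>0. \<kappa> \<le> 1 \<and> 2 * \<kappa> < \<sigma> \<and> summable (\<lambda>n. s n powr \<kappa>)"
  assumes lower: "\<And>\<tau>. 0 \<le> \<tau> \<Longrightarrow> \<tau> < \<rho> \<Longrightarrow>
     frequently (\<lambda>r. \<exists>M. (\<forall>n<M. 1 \<le> s n * r\<^sup>2) \<and> r powr \<tau> \<le> real M * ln 2) at_top"
  shows "entire_order (\<lambda>z. (1 - of_real t * z\<^sup>2) * f z) = ereal \<rho>"
proof -
  define \<psi> where "\<psi> = (\<lambda>z. (1 - of_real t * z\<^sup>2) * f z)"
  have \<psi>_holo: "\<psi> holomorphic_on UNIV" unfolding \<psi>_def by (intro holomorphic_intros holo)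
  define L where "L = (\<lambda>r. ln (max_modulus \<psi> r))"
  have ge: "(1 + t * r\<^sup>2) * (\<Prod>n<M. 1 + s n * r\<^sup>2) \<le> max_modulus \<psi> r" if r: "r \<ge> 0" for r M
  proof -
    have sq: "1 - of_real t * (\<i> * of_real r)\<^sup>2 = complex_of_real (1 + t * r\<^sup>2)" by (simp add: power_mult_distrib)
    have "(1 + t * r\<^sup>2) * (\<Prod>n<M. 1 + s n * r\<^sup>2) \<le> norm (complex_of_real (1 + t * r\<^sup>2)) * norm (f (\<i> * of_real r))"
      using t by (intro mult_mono norm_imaginary_axis_ge[OF s ul]) (auto simp del: of_real_add intro!: prod_nonneg add_nonneg_nonneg mult_nonneg_nonneg less_imp_le[OF s])
    also have "\<dots> = norm (\<psi> (\<i> * of_real r))" unfolding \<psi>_def sq norm_mult ..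
    also have "\<dots> \<le> max_modulus \<psi> r" using r by (intro norm_le_max_modulus \<psi>_holo) (simp add: norm_mult)
    finally show ?thesis .
  qed
  have L1: "ln (1 + t * r\<^sup>2) \<le> L r" if "r \<ge> 0" for r
    using ge[OF that, of 0] t unfolding L_def by (intro ln_mono) (auto simp: add_pos_nonneg)
  have L2: "real M * ln 2 \<le> L r" if "r \<ge> 0" "\<forall>n<M. 1 \<le> s n * r\<^sup>2" for r M
  proof -
    have "(2::real) ^ M = 1 * (\<Prod>n<M. 2)" by simp
    also have "\<dots> \<le> (1 + t * r\<^sup>2) * (\<Prod>n<M. 1 + s n * r\<^sup>2)"
    proof (intro mult_mono prod_mono)
      fix n assume "n \<in> {..<M}"
      thus "0 \<le> (2::real) \<and> 2 \<le> 1 + s n * r\<^sup>2" using that(2) by force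
    qed (use t in \<open>auto intro!: prod_nonneg add_nonneg_nonneg mult_nonneg_nonneg less_imp_le[OF s]\<close>)
    also have "\<dots> \<le> max_modulus \<psi> r" by (rule ge) fact
    finally have "ln (2 ^ M) \<le> L r" unfolding L_def by (intro ln_mono) auto
    thus ?thesis by (simp add: ln_realpow)
  qed
  have "entire_order \<psi> = ereal \<rho>"
  proof (rule entire_order_eqI)
    show "eventually (\<lambda>r. ln (max_modulus \<psi> r) > 0) at_top"
      using eventually_gt_at_top[of 0]
    proof eventually_elim
      case (elim r)
      have "0 < t * r\<^sup>2" using t elim by (intro mult_pos_pos) auto
      hence "0 < ln (1 + t * r\<^sup>2)" by simp
      thus ?case using L1[of r] elim unfolding L_def by linarith
    qed
  next
    fix \<sigma> assume "\<sigma> > \<rho>"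
    then obtain \<kappa> where \<kappa>: "\<kappa> > 0" "\<kappa> \<le> 1" "2 * \<kappa> < \<sigma>" "summable (\<lambda>n. s n powr \<kappa>)"
      using upper by blast
    obtain B where B: "\<And>N z. norm z \<ge> 1 \<Longrightarrow> norm (partial_product s N z) \<le> exp (B * norm z powr (2 * \<kappa>))"
      using norm_partial_product_le[OF s \<kappa>(1,2,4)] by blast
    define B' where "B' = (1 + 1 / \<kappa>) * t powr \<kappa> + B"
    have le: "max_modulus \<psi> r \<le> exp (B' * r powr (2 * \<kappa>))" if r: "r \<ge> 1" for r
    proof (rule max_modulus_le)
      fix z :: complex assume z: "norm z = r"
      have "norm (f z) \<le> exp (B * r powr (2 * \<kappa>))"
      proof (rule tendsto_upperbound[OF tendsto_norm[OF partial_product_tendsto[OF s ul]]])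
        show "\<forall>\<^sub>F N in sequentially. norm (partial_product s N z) \<le> exp (B * r powr (2 * \<kappa>))"
          using B[of z] z r by simp
      qed auto
      moreover have "norm (1 - of_real t * z\<^sup>2) \<le> exp ((1 + 1 / \<kappa>) * (t * r\<^sup>2) powr \<kappa>)"
      proof -
        have "norm (1 - of_real t * z\<^sup>2) \<le> 1 + t * r\<^sup>2"
          using norm_triangle_ineq4[of 1 "of_real t * z\<^sup>2"] t z by (simp add: norm_mult norm_power)
        also have "\<dots> \<le> exp ((1 + 1 / \<kappa>) * (t * r\<^sup>2) powr \<kappa>)"
          using t \<kappa> by (intro one_plus_le_exp_powr) auto
        finally show ?thesis .
      qed
      moreover have "(t * r\<^sup>2) powr \<kappa> = t powr \<kappa> * r powr (2 * \<kappa>)"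
        using r t by (simp add: powr_mult powr_powr flip: powr_numeral)
      ultimately have "norm (\<psi> z) \<le> exp ((1 + 1 / \<kappa>) * (t powr \<kappa> * r powr (2 * \<kappa>))) * exp (B * r powr (2 * \<kappa>))"
        unfolding \<psi>_def norm_mult by (intro mult_mono) auto
      also have "\<dots> = exp (B' * r powr (2 * \<kappa>))"
        by (simp add: B'_def algebra_simps flip: exp_add)
      finally show "norm (\<psi> z) \<le> exp (B' * r powr (2 * \<kappa>))" .
    qed (use r in auto)
    have "eventually (\<lambda>r. B' * r powr (2 * \<kappa>) \<le> r powr \<sigma>) at_top"
      using \<kappa>(3) by real_asymp
    thus "eventually (\<lambda>r. ln (max_modulus \<psi> r) \<le> r powr \<sigma>) at_top"
      using eventually_ge_at_top[of 1]
    proof eventually_elim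
      case (elim r)
      have "0 < 1 + t * r\<^sup>2" using t by (simp add: add_pos_nonneg)
      also have "\<dots> \<le> max_modulus \<psi> r" using ge[of r 0] elim by simp
      finally have "ln (max_modulus \<psi> r) \<le> ln (exp (B' * r powr (2 * \<kappa>)))"
        using le elim by (subst ln_le_cancel_iff) auto
      thus ?case using elim by simp
    qed
  next
    fix \<tau> assume \<tau>: "\<tau> < \<rho>"
    show "frequently (\<lambda>r. r powr \<tau> \<le> ln (max_modulus \<psi> r)) at_top"
    proof (cases "\<tau> \<ge> 0")
      case True
      have "frequently (\<lambda>r. (\<exists>M. (\<forall>n<M. 1 \<le> s n * r\<^sup>2) \<and> r powr \<tau> \<le> real M * ln 2) \<and> r \<ge> 0) at_top"
        using lower[OF True \<tau>] eventually_ge_at_top[of 0] by (rule frequently_eventually_frequently)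
      thus ?thesis
      proof (rule frequently_elim1)
        fix r assume "(\<exists>M. (\<forall>n<M. 1 \<le> s n * r\<^sup>2) \<and> r powr \<tau> \<le> real M * ln 2) \<and> r \<ge> 0"
        then obtain M where M: "\<forall>n<M. 1 \<le> s n * r\<^sup>2" "r powr \<tau> \<le> real M * ln 2" "r \<ge> 0" by auto
        from M(2) L2[OF M(3,1)] show "r powr \<tau> \<le> ln (max_modulus \<psi> r)"
          unfolding L_def by (rule order_trans)
      qed
    next
      case False
      \<comment> \<open>For negative \<open>\<tau>\<close> the power is at most 1, and the factor of
        the generic pair alone suffices.\<close>
      have "eventually (\<lambda>r. 1 \<le> ln (1 + t * r\<^sup>2)) at_top" using t by real_asymp
      hence "eventually (\<lambda>r. r powr \<tau> \<le> ln (max_modulus \<psi> r)) at_top"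
        using eventually_ge_at_top[of 1]
      proof eventually_elim
        case (elim r)
        have "r powr \<tau> \<le> r powr 0" using elim False by (intro powr_mono) auto
        also have "\<dots> = 1" using elim by simp
        finally show ?case using elim L1[of r] by (simp add: L_def)
      qed
      thus ?thesis by (rule eventually_frequently[rotated]) simp
    qed
  qed
  thus ?thesis by (simp add: \<psi>_def)
qed

section \<open>Choice of the zeros\<close>

text \<open>For \<open>\<rho> > 0\<close> the sequence is
  \<open>(1 / (m (ln m)^2)) powr (2 / \<rho>)\<close> with \<open>m = n + 3\<close>. The squared
  logarithm makes \<open>s n powr (\<rho> / 2)\<close> summable, which for \<open>\<rho> = 2\<close>
  is the required summability of \<open>s\<close> itself.\<close>

lemma exists_zeros_of_order:
  fixes \<rho> :: real
  assumes "0 \<le> \<rho>" "\<rho> \<le> 2"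
  obtains s :: "nat \<Rightarrow> real" where "\<And>n. s n > 0" "inj s" "summable s"
    "\<And>\<sigma>. \<sigma> > \<rho> \<Longrightarrow> \<exists>\<kappa>>0. \<kappa> \<le> 1 \<and> 2 * \<kappa> < \<sigma> \<and> summable (\<lambda>n. s n powr \<kappa>)"
    "\<And>\<tau>. 0 \<le> \<tau> \<Longrightarrow> \<tau> < \<rho> \<Longrightarrow>
     frequently (\<lambda>r. \<exists>M. (\<forall>n<M. 1 \<le> s n * r\<^sup>2) \<and> r powr \<tau> \<le> real M * ln 2) at_top"
proof (cases "\<rho> = 0")
  case True
  \<comment> \<open>Geometric decay makes every positive \<open>\<kappa>\<close> admissible, and no
    \<open>\<tau>\<close> satisfies \<open>0 \<le> \<tau> < \<rho>\<close> here.\<close>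
  define s where "s = (\<lambda>n. (1 / 4) ^ n :: real)"
  show ?thesis
  proof (rule that[of s])
    show "inj s" by (intro injI) (simp add: s_def power_inject_exp')
    show "summable s" unfolding s_def by (rule summable_geometric) simp
    fix \<sigma> assume "\<sigma> > \<rho>"
    hence \<sigma>: "\<sigma> > 0" using True by simp
    define \<kappa> where "\<kappa> = min 1 (\<sigma> / 4)"
    have \<kappa>: "\<kappa> > 0" "\<kappa> \<le> 1" "2 * \<kappa> < \<sigma>" using \<sigma> by (auto simp: \<kappa>_def)
    have "(\<lambda>n. s n powr \<kappa>) = (\<lambda>n. ((1 / 4) powr \<kappa>) ^ n)"
      by (simp add: s_def fun_eq_iff powr_powr powr_realpow[symmetric] mult.commute)
    moreover have "summable (\<lambda>n. ((1 / 4) powr \<kappa>) ^ n)"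
      using \<kappa> powr_less_mono2[of \<kappa> "1 / 4" 1] by (intro summable_geometric) auto
    ultimately show "\<exists>\<kappa>>0. \<kappa> \<le> 1 \<and> 2 * \<kappa> < \<sigma> \<and> summable (\<lambda>n. s n powr \<kappa>)"
      using \<kappa> by (intro exI[of _ \<kappa>]) simp
  qed (use True in \<open>auto simp: s_def\<close>)
next
  case False
  hence \<rho>: "\<rho> > 0" using assms by simp
  \<comment> \<open>The shift by 3, which exceeds \<open>e\<close>, makes all the logarithms at
    least 1.\<close>
  define g where "g = (\<lambda>n. 1 / (real (n + 3) * (ln (real (n + 3)))\<^sup>2))"
  have ln3: "ln (real (n + 3)) \<ge> 1" for n
  proof -
    have "exp 1 \<le> real (n + 3)" using exp_le by linarith
    thus ?thesis by (subst ln_ge_iff) auto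
  qed
  have g_pos: "g n > 0" for n
    using ln3[of n] by (auto simp: g_def intro!: divide_pos_pos mult_pos_pos)
  have g_anti: "g m < g n" if "n < m" for m n
    unfolding g_def
  proof (intro divide_strict_left_mono mult_strict_mono power_strict_mono)
    show "ln (real (n + 3)) < ln (real (m + 3))" using that by (subst ln_less_cancel_iff) auto
  qed (use that ln3[of n] ln3[of m] in \<open>auto intro!: mult_pos_pos\<close>)
  have g_le1: "g n \<le> 1" for n
  proof -
    have "1 * 1\<^sup>2 \<le> real (n + 3) * (ln (real (n + 3)))\<^sup>2"
      using ln3[of n] by (intro mult_mono power_mono) auto
    thus ?thesis by (simp add: g_def)
  qed
  have g_summable: "summable g"
  proof (rule summable_comparison_test')
    \<comment> \<open>A telescoping majorant, based on \<open>1 / m \<le> ln m - ln (m - 1)\<close>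
      with \<open>m = n + 3\<close>.\<close>
    have "(\<lambda>n. 1 / ln (real (n + 2))) \<longlonglongrightarrow> 0" by real_asymp
    from telescope_summable'[OF this]
    show "summable (\<lambda>n. 1 / ln (real (n + 2)) - 1 / ln (real (Suc n + 2)))" .
    fix n :: nat
    define m where "m = real (n + 3)"
    have m: "m \<ge> 3" by (simp add: m_def)
    have lm: "0 < ln (m - 1)" "ln (m - 1) \<le> ln m" using m by auto
    have "ln (m - 1) - ln m = ln ((m - 1) / m)" using m by (simp add: ln_div)
    also have "\<dots> \<le> (m - 1) / m - 1" using m by (intro ln_le_minus_one) auto
    also have "\<dots> = - (1 / m)" using m by (simp add: field_simps)
    finally have d: "1 / m \<le> ln m - ln (m - 1)" by simp
    have "g n = 1 / m / (ln m * ln m)" by (simp add: g_def m_def power2_eq_square)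
    also have "\<dots> \<le> (ln m - ln (m - 1)) / (ln (m - 1) * ln m)"
      using d lm m by (intro frac_le mult_right_mono) (auto intro: mult_pos_pos order.trans[OF _ d])
    also have "\<dots> = 1 / ln (m - 1) - 1 / ln m"
      using lm by (simp add: field_simps)
    finally show "norm (g n) \<le> 1 / ln (real (n + 2)) - 1 / ln (real (Suc n + 2))"
      using g_pos[of n] by (simp add: m_def add_ac)
  qed
  define s where "s = (\<lambda>n. g n powr (2 / \<rho>))"
  have s_anti: "s m < s n" if "n < m" for m n
    unfolding s_def using g_anti[OF that] g_pos \<rho> by (intro powr_less_mono2) (auto intro: less_imp_le)
  show ?thesis
  proof (rule that[of s])
    show "s n > 0" for n using g_pos[of n] by (simp add: s_def)
    show "inj s" by (intro injI) (metis s_anti less_irrefl linorder_neqE_nat)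
    show "summable s"
    proof (rule summable_comparison_test'[OF g_summable])
      fix n
      have "g n powr (2 / \<rho>) \<le> g n powr 1"
        using assms \<rho> g_le1 g_pos[of n] by (intro powr_mono') auto
      thus "norm (s n) \<le> g n" using g_pos[of n] by (simp add: s_def)
    qed
    fix \<sigma> assume "\<sigma> > \<rho>"
    have "(\<lambda>n. s n powr (\<rho> / 2)) = g"
      using g_pos \<rho> by (auto simp: s_def powr_powr fun_eq_iff less_imp_le)
    thus "\<exists>\<kappa>>0. \<kappa> \<le> 1 \<and> 2 * \<kappa> < \<sigma> \<and> summable (\<lambda>n. s n powr \<kappa>)"
      using g_summable assms \<rho> \<open>\<sigma> > \<rho>\<close> by (intro exI[of _ "\<rho> / 2"]) simp
  next
    fix \<tau> assume \<tau>: "0 \<le> \<tau>" "\<tau> < \<rho>"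
    \<comment> \<open>\<open>r M\<close> is \<open>s M powr (- 1 / 2)\<close>, the modulus of the
      pair with index \<open>M\<close>, so \<open>s n * (r M)^2 \<ge> 1\<close> for all
      \<open>n < M\<close>.\<close>
    define r where "r = (\<lambda>M. g M powr (- 1 / \<rho>))"
    define q where "q = \<tau> / \<rho>"
    have q: "0 \<le> q" "q < 1" using \<tau> \<rho> by (auto simp: q_def)
    have r_pos: "r M > 0" for M using g_pos[of M] by (simp add: r_def)
    have r_lim: "filterlim r at_top sequentially"
      unfolding r_def g_def using \<rho> by real_asymp
    have ev: "eventually (\<lambda>M. (\<exists>N. (\<forall>n<N. 1 \<le> s n * (r M)\<^sup>2) \<and> r M powr \<tau> \<le> real N * ln 2)) sequentially"
    proof -
      \<comment> \<open>The left side is \<open>(1 / g M) powr q = r M powr \<tau>\<close>; it grows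
        more slowly than \<open>M\<close> since \<open>q < 1\<close>.\<close>
      have "eventually (\<lambda>M. (real (M + 3) * (ln (real (M + 3)))\<^sup>2) powr q \<le> real M * ln 2) sequentially"
        using q by real_asymp
      thus ?thesis
      proof eventually_elim
        case (elim M)
        have "(r M)\<^sup>2 = r M powr 2" using r_pos[of M] by simp
        hence r2: "(r M)\<^sup>2 = g M powr (- 2 / \<rho>)" by (simp add: r_def powr_powr)
        have "1 \<le> s n * (r M)\<^sup>2" if "n < M" for n
        proof -
          have "1 = s M * (r M)\<^sup>2"
            unfolding s_def r2 using g_pos[of M] by (simp flip: powr_add)
          also have "\<dots> \<le> s n * (r M)\<^sup>2" using s_anti[OF that] by (intro mult_right_mono) auto
          finally show ?thesis .
        qed
        moreover have "r M powr \<tau> = (1 / g M) powr q"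
          using g_pos[of M] by (simp add: r_def powr_powr q_def powr_divide powr_minus_divide)
        hence "r M powr \<tau> \<le> real M * ln 2" using elim by (simp add: g_def)
        ultimately show ?case by blast
      qed
    qed
    show "frequently (\<lambda>r. \<exists>M. (\<forall>n<M. 1 \<le> s n * r\<^sup>2) \<and> r powr \<tau> \<le> real M * ln 2) at_top"
      unfolding frequently_def
    proof
      assume "eventually (\<lambda>r. \<not> (\<exists>M. (\<forall>n<M. 1 \<le> s n * r\<^sup>2) \<and> r powr \<tau> \<le> real M * ln 2)) at_top"
      from eventually_compose_filterlim[OF this r_lim] ev
      have "eventually (\<lambda>_. False) sequentially" by eventually_elim blast
      thus False by simp
    qed
  qed
qed

section \<open>The function \<open>\<psi>\<close>: its order, the class of its Gaussian multiples
  and the signs of their coefficients\<close>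

theorem theorem3:
  fixes \<rho> :: real
  assumes "0 \<le> \<rho>" and "\<rho> \<le> 2"
  shows "\<exists>(\<psi> :: complex \<Rightarrow> complex) (lam :: real) (x :: nat \<Rightarrow> real).
           lam \<in> {0, 1} \<and> (\<forall>n. x n \<noteq> 0) \<and>
           (\<forall>z. (\<lambda>n. (1 - z / of_real (x n)) * exp (of_real lam * z / of_real (x n))) has_prod \<psi> z) \<and>
           \<psi> holomorphic_on UNIV \<and> entire_order \<psi> = ereal \<rho> \<and>
           (\<forall>a :: real. a < 0 \<longrightarrow>
              LPa (\<lambda>z. exp (of_real a * z\<^sup>2) * \<psi> z) \<and>
              (\<forall>n0 :: nat. \<exists>n > n0.
                 \<exists>r > 0. taylor_coeff (\<lambda>z. exp (of_real a * z\<^sup>2) * \<psi> z) (n - 1) *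
                         taylor_coeff (\<lambda>z. exp (of_real a * z\<^sup>2) * \<psi> z) (n + 1) = of_real r))"
proof -
  obtain s where s: "\<And>n. s n > 0" "inj s" "summable s"
    and upper: "\<And>\<sigma>. \<sigma> > \<rho> \<Longrightarrow> \<exists>\<kappa>>0. \<kappa> \<le> 1 \<and> 2 * \<kappa> < \<sigma> \<and> summable (\<lambda>n. s n powr \<kappa>)"
    and lower: "\<And>\<tau>. 0 \<le> \<tau> \<Longrightarrow> \<tau> < \<rho> \<Longrightarrow>
     frequently (\<lambda>r. \<exists>M. (\<forall>n<M. 1 \<le> s n * r\<^sup>2) \<and> r powr \<tau> \<le> real M * ln 2) at_top"
    using exists_zeros_of_order[OF assms] by blast
  obtain f where holo: "f holomorphic_on UNIV"
    and ul: "\<And>R. R > 0 \<Longrightarrow> uniform_limit (cball 0 R) (partial_product s) f sequentially"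
    and hp: "\<And>t z. t > 0 \<Longrightarrow> (\<lambda>n. (1 - z / of_real (zeros' t s n)) * exp (z / of_real (zeros' t s n)))
                       has_prod ((1 - of_real t * z\<^sup>2) * f z)"
    using base_function[OF s(1,3)] by blast
  obtain E :: "real fps" where E0: "E $ 0 = 1"
    and limE: "\<And>k. (\<lambda>N. coeff (even_part N * symmetric_part s {..<N}) k) \<longlonglongrightarrow> E $ k"
    and E: "\<And>k. fps_expansion f 0 $ (2 * k) = of_real (E $ k)"
    and real: "\<And>k. fps_expansion f 0 $ k \<in> \<real>"
    using base_coeffs[OF ul[of 1]] by auto
  have nz: "\<not> ((fps_exp a * E) $ k = 0 \<and> (fps_exp a * E) $ Suc k = 0)" if "a < 0" for a k
  proof (rule no_two_consecutive_zero_coeffs[OF limE E0 s(2)])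
    show "s i \<noteq> 0" for i using s(1)[of i] by simp
    show "a \<noteq> 0" using that by simp
    fix i
    show "eventually (\<lambda>N. \<exists>q. real_split q \<and> even_part N * symmetric_part s {..<N} = [:1, - s i:] * q) sequentially"
      using eventually_gt_at_top[of i]
    proof eventually_elim
      case (elim N)
      \<comment> \<open>Taking out the pair with index \<open>i\<close> leaves a real-rooted
        quotient as soon as \<open>N > i\<close>.\<close>
      have "symmetric_part s {..<N} = [:1, - s i:] * symmetric_part s ({..<N} - {i})"
        unfolding symmetric_part_def using elim by (intro prod.remove) auto
      hence "even_part N * symmetric_part s {..<N} = [:1, - s i:] * (even_part N * symmetric_part s ({..<N} - {i}))"
        by (simp only: mult_ac)
      thus ?case using real_split_even_part[of "{..<N} - {i}" N s] by blast
    qed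
  qed
  \<comment> \<open>\<open>t\<close> avoids the exceptional values for all \<open>a < 0\<close> at
    once, so a single \<open>\<psi>\<close> serves every \<open>a\<close>.\<close>
  obtain t where t: "0 < t" "t < 1"
    and one_zero: "\<And>a k l. a < 0 \<Longrightarrow> (fps_exp a * ((1 - fps_const t * fps_X) * E)) $ k = 0 \<Longrightarrow>
       (fps_exp a * ((1 - fps_const t * fps_X) * E)) $ l = 0 \<Longrightarrow> k = l"
    using exists_generic_factor[OF E0 nz] by blast
  define \<psi> where "\<psi> = (\<lambda>z. (1 - of_real t * z\<^sup>2) * f z)"
  define x where "x = zeros' t s"
  have x: "x n \<noteq> 0" for n unfolding x_def by (rule zeros'_nonzero[OF t(1) s(1)])
  have prod: "(\<lambda>n. (1 - z / of_real (x n)) * exp (of_real 1 * z / of_real (x n))) has_prod \<psi> z" for z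
    using hp[OF t(1), of z] by (simp add: x_def \<psi>_def)
  have lpa: "LPa (\<lambda>z. exp (of_real a * z\<^sup>2) * \<psi> z)" if "a < 0" for a
  proof -
    have "(\<lambda>k. \<bar>x k\<bar> powr (- 1 - 1)) = (\<lambda>k. (1 / x k)\<^sup>2)"
      using x by (simp add: fun_eq_iff powr_minus_divide power_divide)
    hence "summable (\<lambda>k. \<bar>x k\<bar> powr (- 1 - 1))"
      using summable_zeros'[OF s(1,3), of t] by (simp add: x_def)
    hence "LP_repr (\<lambda>z. exp (of_real a * z\<^sup>2) * \<psi> z) 1 0 a 0 1 \<infinity> x"
      unfolding LP_repr_def using that x prod by (auto intro!: exI[of _ \<psi>])
    thus ?thesis unfolding LPa_def using that by blast
  qed
  have signs: "\<exists>n>n0. \<exists>r>0. taylor_coeff (\<lambda>z. exp (of_real a * z\<^sup>2) * \<psi> z) (n - 1) *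
                         taylor_coeff (\<lambda>z. exp (of_real a * z\<^sup>2) * \<psi> z) (n + 1) = of_real r"
    if "a < 0" for a n0
  proof -
    define A where "A = (\<lambda>k. (fps_exp a * ((1 - fps_const t * fps_X) * E)) $ k)"
    have tc: "taylor_coeff (\<lambda>z. exp (of_real a * z\<^sup>2) * \<psi> z) (2 * k) = of_real (A k)" for k
      unfolding \<psi>_def A_def by (rule taylor_coeff_gaussian_mult(1)[OF holo E real])
    have "\<exists>k>n0. A k * A (Suc k) > 0"
    proof (rule sign_repetition[OF s(1) ul t(1) holo])
      show "taylor_coeff (\<lambda>z. exp (of_real a * z\<^sup>2) * ((1 - of_real t * z\<^sup>2) * f z)) (2 * k) = of_real (A k)" for k
        using tc[of k] by (simp add: \<psi>_def)
      show "taylor_coeff (\<lambda>z. exp (of_real a * z\<^sup>2) * ((1 - of_real t * z\<^sup>2) * f z)) k \<in> \<real>" for k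
        by (rule taylor_coeff_gaussian_mult(2)[OF holo E real])
      show "k = l" if "A k = 0" "A l = 0" for k l
        using one_zero[OF \<open>a < 0\<close>] that unfolding A_def by blast
    qed
    then obtain k where k: "k > n0" "A k * A (Suc k) > 0" by blast
    show ?thesis
    \<comment> \<open>An odd \<open>n\<close> makes both neighbouring coefficients
      even-indexed.\<close>
    proof (intro exI[of _ "2 * k + 1"] exI[of _ "A k * A (Suc k)"] conjI)
      have "2 * k + 1 + 1 = 2 * Suc k" by simp
      thus "taylor_coeff (\<lambda>z. exp (of_real a * z\<^sup>2) * \<psi> z) (2 * k + 1 - 1) *
            taylor_coeff (\<lambda>z. exp (of_real a * z\<^sup>2) * \<psi> z) (2 * k + 1 + 1) = of_real (A k * A (Suc k))"
        by (simp only: tc add_diff_cancel_right' of_real_mult)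
    qed (use k in auto)
  qed
  have "entire_order \<psi> = ereal \<rho>"
    unfolding \<psi>_def by (rule entire_order_base_function[OF s(1) t(1) ul holo upper lower])
  moreover have "\<psi> holomorphic_on UNIV"
    unfolding \<psi>_def by (intro holomorphic_intros holo)
  ultimately show ?thesis
    using prod x lpa signs by (intro exI[of _ \<psi>] exI[of _ 1] exI[of _ x]) auto
qed

end
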